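(* Let $\alpha\in(0,1)$ be irrational and let $\mathbf G_n\sim G(n,n^{-\alpha})$. For every closed term $\tau$ of the language $\mathrm{Agg}[\mathcal F_{LP},\mathrm{Avg},\mathrm{LAvg},\mathrm{Max}]$, the sequence of random variables $[\![\tau]\!]_{\mathbf G_n}$ converges in probability to a constant as $n\to\infty$.
   Context: $G(n,p)$ is the random graph on vertex set $[n]=\{1,\dots,n\}$ in which each pair of distinct vertices is an edge independently with probability $p$. Graphs are finite, undirected, without loops. $\mathcal F_{LP}$ is the set of all Lipschitz functions $f:\mathbb R^m\to\mathbb R$, $m\ge1$. The terms of $\mathrm{Agg}[\mathcal F_{LP},\mathrm{Avg},\mathrm{LAvg},\mathrm{Max}]$, with node variables, are built inductively and interpreted in a graph $G$ with an assignment of vertices of $G$ to the free variables as follows. - Atomic terms: constants $c\in\mathbb R_{\ge0}$ (value $c$); $\mathrm E(u,v)$ (value $1$ if $\{u,v\}\in E(G)$, else $0$); $u=v$ (value $1$ if equal, else $0$). - $f(\tau_1,\dots,\tau_m)$ for $f\in\mathcal F_{LP}$ of arity $m$: apply $f$ to the values. - $\mathrm{Avg}_v\,\tau(\bar u,v)$: value $\frac1{|V(G)|}\sum_{v\in V(G)}\tau(\bar u,v)$. - $\mathrm{LAvg}_{w\mathrm Ev}\,\tau(w,\bar u,v)$ (free variables $w,\bar u$): the average of $\tau(w,\bar u,v)$ over the neighbours $v$ of $w$, and $0$ if $w$ has no neighbours. - $\mathrm{Max}_v\,\tau(\bar u,v)$: the maximum of $\tau(\bar u,v)$ over all $v\in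 V(G)$. A term is closed if it has no free variables; $[\![\tau]\!]_G$ denotes the value of a closed term $\tau$ in $G$. *)

theory Defs
  imports "HOL-Probability.Probability"
begin

record 'v graph =
  verts :: "'v set"
  edges :: "'v set set"

definition neighbours :: "'v graph \<Rightarrow> 'v \<Rightarrow> 'v set" where
  "neighbours G a = {b \<in> verts G. {a, b} \<in> edges G}"

definition vertex_pairs :: "'v set \<Rightarrow> 'v set set" where
  "vertex_pairs V = {{a, b} | a b. a \<in> V \<and> b \<in> V \<and> a \<noteq> b}"

definition gnp :: "nat \<Rightarrow> real \<Rightarrow> nat graph pmf" where
  "gnp n p =
     map_pmf (\<lambda>present. \<lparr>verts = {1..n}, edges = {e \<in> vertex_pairs {1..n}. present e}\<rparr>)
       (Pi_pmf (vertex_pairs {1..n}) False (\<lambda>_. bernoulli_pmf p))"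

text \<open>
  An $m$-ary real function is a function on lists, of which only the values on lists of
  length $m$ matter; $\mathbb{R}^m$ carries the Euclidean norm.
\<close>

definition lipschitz_fun :: "nat \<Rightarrow> (real list \<Rightarrow> real) \<Rightarrow> bool" where
  "lipschitz_fun m f \<longleftrightarrow>
     (\<exists>C\<ge>0. \<forall>xs ys. length xs = m \<longrightarrow> length ys = m \<longrightarrow>
        \<bar>f xs - f ys\<bar> \<le> C * L2_set (\<lambda>i. xs ! i - ys ! i) {..<m})"

type_synonym var = nat

text \<open>
  \<open>AvgT v t\<close> and \<open>MaxT v t\<close> bind \<open>v\<close> in \<open>t\<close>. \<open>LAvgT w v t\<close> is the average
  over the neighbours \<open>v\<close> of \<open>w\<close>: it binds \<open>v\<close>, whereas \<open>w\<close> is free in it.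
\<close>

datatype agg_term =
    ConstT real
  | EdgeT var var
  | EqT var var
  | FunT "real list \<Rightarrow> real" "agg_term list"
  | AvgT var agg_term
  | LAvgT var var agg_term
  | MaxT var agg_term

text \<open>The raw terms that are terms of $\mathrm{Agg}[\mathcal{F}_{LP},\mathrm{Avg},\mathrm{LAvg},\mathrm{Max}]$:\<close>

fun agg_lp_term :: "agg_term \<Rightarrow> bool" where
  "agg_lp_term (ConstT c) \<longleftrightarrow> c \<ge> 0"
| "agg_lp_term (EdgeT u v) \<longleftrightarrow> True"
| "agg_lp_term (EqT u v) \<longleftrightarrow> True"
| "agg_lp_term (FunT f ts) \<longleftrightarrow>
     ts \<noteq> [] \<and> lipschitz_fun (length ts) f \<and> (\<forall>t \<in> set ts. agg_lp_term t)"
| "agg_lp_term (AvgT v t) \<longleftrightarrow> agg_lp_term t"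
| "agg_lp_term (LAvgT w v t) \<longleftrightarrow> w \<noteq> v \<and> agg_lp_term t"
| "agg_lp_term (MaxT v t) \<longleftrightarrow> agg_lp_term t"

fun free_vars :: "agg_term \<Rightarrow> var set" where
  "free_vars (ConstT c) = {}"
| "free_vars (EdgeT u v) = {u, v}"
| "free_vars (EqT u v) = {u, v}"
| "free_vars (FunT f ts) = (\<Union>t \<in> set ts. free_vars t)"
| "free_vars (AvgT v t) = free_vars t - {v}"
| "free_vars (LAvgT w v t) = insert w (free_vars t - {v})"
| "free_vars (MaxT v t) = free_vars t - {v}"

definition closed_term :: "agg_term \<Rightarrow> bool" where
  "closed_term t \<longleftrightarrow> free_vars t = {}"

fun term_value :: "'v graph \<Rightarrow> (var \<Rightarrow> 'v) \<Rightarrow> agg_term \<Rightarrow> real" where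
  "term_value G \<nu> (ConstT c) = c"
| "term_value G \<nu> (EdgeT u v) = (if {\<nu> u, \<nu> v} \<in> edges G then 1 else 0)"
| "term_value G \<nu> (EqT u v) = (if \<nu> u = \<nu> v then 1 else 0)"
| "term_value G \<nu> (FunT f ts) = f (map (term_value G \<nu>) ts)"
| "term_value G \<nu> (AvgT v t) =
     (\<Sum>a \<in> verts G. term_value G (\<nu>(v := a)) t) / real (card (verts G))"
| "term_value G \<nu> (LAvgT w v t) =
     (if neighbours G (\<nu> w) = {} then 0
      else (\<Sum>a \<in> neighbours G (\<nu> w). term_value G (\<nu>(v := a)) t)
             / real (card (neighbours G (\<nu> w))))"
| "term_value G \<nu> (MaxT v t) = Max ((\<lambda>a. term_value G (\<nu>(v := a)) t) ` verts G)"

lemma term_value_cong: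
  assumes "\<And>x. x \<in> free_vars t \<Longrightarrow> \<nu> x = \<mu> x"
  shows "term_value G \<nu> t = term_value G \<mu> t"
  using assms
proof (induction t arbitrary: \<nu> \<mu>)
  case (FunT f ts)
  have "term_value G \<nu> t = term_value G \<mu> t" if "t \<in> set ts" for t
    by (rule FunT.IH[OF that], rule FunT.prems) (use that in auto)
  then have "map (term_value G \<nu>) ts = map (term_value G \<mu>) ts"
    by (intro map_cong refl)
  then show ?case by (simp only: term_value.simps)
next
  case (AvgT v t)
  have "term_value G (\<nu>(v := a)) t = term_value G (\<mu>(v := a)) t" for a
    by (rule AvgT.IH) (use AvgT.prems in auto)
  then show ?case by simp
next
  case (LAvgT w v t)
  have "term_value G (\<nu>(v := a)) t = term_value G (\<mu>(v := a)) t" for a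
    by (rule LAvgT.IH) (use LAvgT.prems in auto)
  moreover have "\<nu> w = \<mu> w" using LAvgT.prems by simp
  ultimately show ?case by simp
next
  case (MaxT v t)
  have "term_value G (\<nu>(v := a)) t = term_value G (\<mu>(v := a)) t" for a
    by (rule MaxT.IH) (use MaxT.prems in auto)
  then show ?case by simp
qed auto

text \<open>The assignment used in the value of a closed term is irrelevant.\<close>

definition closed_term_value :: "agg_term \<Rightarrow> 'v graph \<Rightarrow> real" where
  "closed_term_value t G = term_value G (\<lambda>_. undefined) t"

lemma closed_term_value_eq:
  "closed_term t \<Longrightarrow> closed_term_value t G = term_value G \<nu> t"
  unfolding closed_term_def closed_term_value_def by (rule term_value_cong) simp

text \<open>
  Convergence to a constant depends only on the individual laws of the random variables, so
  each \<open>X n\<close> may live on its own probability space.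
\<close>

definition converges_in_prob_to_const ::
    "(nat \<Rightarrow> 'a measure) \<Rightarrow> (nat \<Rightarrow> 'a \<Rightarrow> real) \<Rightarrow> real \<Rightarrow> bool" where
  "converges_in_prob_to_const M X c \<longleftrightarrow>
     (\<forall>\<epsilon>>0. (\<lambda>n. measure (M n) {\<omega> \<in> space (M n). \<bar>X n \<omega> - c\<bar> > \<epsilon>}) \<longlonglongrightarrow> 0)"

end

theory Submission
  imports Defs
begin

text \<open>
  Call a vertex set \<open>A\<close> strong at level \<open>k\<close> if no extension by at most \<open>k\<close> vertices has negative
  weight, the weight being (new vertices) minus \<open>\<alpha>\<close> times (new edges). For fixed \<open>A\<close> the expected
  number of copies of an extension of weight \<open>w\<close> is about \<open>n powr w\<close>, and since \<open>\<alpha>\<close> is irrational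
  the extensions of a strong set have positive weight. High moments bound the number of copies from
  above and Chebyshev on disjoint vertex blocks bounds it from below, uniformly in \<open>A\<close>;
  hence almost all copies are generic, i.e. induced and again strong.

  An Ehrenfeucht--Fraisse argument then shows that the value of a term at a tuple depends, up to
  \<open>\<epsilon>\<close>, only on the isomorphism type of a strong set containing the tuple. For \<open>Max\<close>, each
  vertex lies in a bounded strong extension of \<open>A\<close>, whose type is realised by a generic copy in
  every other typical graph. For the averages, almost every vertex (almost every
  neighbour) is a generic copy of an isolated vertex (of a pendant edge) over \<open>A\<close>. Since the empty
  set is strong with high probability, the values of a closed term in any two typical graphs differ
  by at most \<open>\<epsilon>\<close>.
\<close>

section \<open>Events in the random graph\<close>

text \<open>Uniformity over roots shapes the counting. The bounds must hold for all choices of s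
  roots at once, so a failure probability has to be o(n^-s). One first or second moment is too weak
  for that, and so the order of the moments and the number of blocks grow with s. Strongness is
  truncated at a level because only extensions of bounded size can be controlled; every averaging or
  maximum spends part of the level. The limit is never computed. The induction compares two graphs,
  possibly with different numbers of vertices, that satisfy the same high-probability event; the
  constant appears only at the end, by completeness of the reals. An average tolerates a small
  fraction of vertices in atypical position, provided that values are bounded, whereas a maximum
  sees every single vertex: this is what makes closures necessary. Irrationality and \<alpha> < 1
  enter in one place each: the former turns nonnegative weights of nonempty extensions into positive
  ones, the latter gives a pendant edge positive weight, so that vertices of strong sets typically
  have many neighbours.\<close>

lemma finite_vertex_pairs: "finite V \<Longrightarrow> finite (vertex_pairs V)"
  by (rule finite_subset[of _ "Pow V"]) (auto simp: vertex_pairs_def)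

lemma card_vertex_pair: "e \<in> vertex_pairs V \<Longrightarrow> card e = 2"
  by (auto simp: vertex_pairs_def)

lemma vertex_pairs_iff: "e \<in> vertex_pairs V \<longleftrightarrow> e \<subseteq> V \<and> card e = 2"
  by (auto simp: vertex_pairs_def card_2_iff)

lemma prob_gnp:
  "measure_pmf.prob (gnp n p) {G. Q (edges G)} =
   measure_pmf.prob (Pi_pmf (vertex_pairs {1..n}) False (\<lambda>_. bernoulli_pmf p))
     {\<omega>. Q {e \<in> vertex_pairs {1..n}. \<omega> e}}"
  unfolding gnp_def by (simp add: measure_map_pmf vimage_def)

lemma gnp_support:
  assumes "G \<in> set_pmf (gnp n p)"
  shows "verts G = {1..n}" "edges G \<subseteq> vertex_pairs {1..n}"
  using assms by (auto simp: gnp_def)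

lemma finite_set_pmf_gnp: "finite (set_pmf (gnp n p))"
  unfolding gnp_def set_map_pmf
  by (rule finite_subset[of _ "(\<lambda>E. \<lparr>verts = {1..n}, edges = E\<rparr>) ` Pow (vertex_pairs {1..n})"])
     (auto simp: finite_vertex_pairs)

lemma integrable_gnp: "integrable (measure_pmf (gnp n p)) (f :: _ \<Rightarrow> real)"
  by (rule integrable_measure_pmf_finite[OF finite_set_pmf_gnp])

lemma prob_gnp_superset:
  assumes p: "0 \<le> p" "p \<le> 1" and F: "F \<subseteq> vertex_pairs {1..n}"
  shows "measure_pmf.prob (gnp n p) {G. F \<subseteq> edges G} = p ^ card F"
proof -
  let ?P = "vertex_pairs {1..n}"
  have fin: "finite ?P" by (simp add: finite_vertex_pairs)
  have "{\<omega>. F \<subseteq> {e \<in> ?P. \<omega> e}} = Pi ?P (\<lambda>e. if e \<in> F then {True} else UNIV)"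
    using F by (auto simp: Pi_def split: if_splits)
  then have "measure_pmf.prob (gnp n p) {G. F \<subseteq> edges G} =
      (\<Prod>e\<in>?P. measure_pmf.prob (bernoulli_pmf p) (if e \<in> F then {True} else UNIV))"
    using prob_gnp[of n p "\<lambda>E. F \<subseteq> E"] measure_Pi_pmf_Pi[OF fin] by simp
  also have "\<dots> = (\<Prod>e\<in>?P. if e \<in> F then p else 1)"
    by (intro prod.cong refl) (use p in \<open>auto simp: measure_pmf_single\<close>)
  also have "\<dots> = (\<Prod>e\<in>F. p)"
    using fin F by (subst prod.inter_restrict[symmetric]) (auto intro: prod.cong simp: Int_absorb1)
  finally show ?thesis by simp
qed

text \<open>Events that look at disjoint sets of pairs depend on disjoint groups of coordinates of
  the product measure. This will multiply the failure probabilities of the blocks.\<close>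

lemma prob_gnp_indep:
  fixes F :: "'i \<Rightarrow> nat set set"
  assumes I: "finite I" "I \<noteq> {}"
    and F: "\<And>i. i \<in> I \<Longrightarrow> F i \<subseteq> vertex_pairs {1..n}" "disjoint_family_on F I"
  shows "measure_pmf.prob (gnp n p) {G. \<forall>i\<in>I. Q i (edges G \<inter> F i)} =
         (\<Prod>i\<in>I. measure_pmf.prob (gnp n p) {G. Q i (edges G \<inter> F i)})"
proof -
  let ?P = "vertex_pairs {1..n}" and ?M = "Pi_pmf (vertex_pairs {1..n}) False (\<lambda>_. bernoulli_pmf p)"
  have fin: "finite ?P" by (simp add: finite_vertex_pairs)
  have finF: "finite (F i)" if "i \<in> I" for i
    using finite_subset[OF F(1)[OF that] fin] .
  let ?X = "\<lambda>i \<omega>. restrict (\<lambda>e. \<omega> e) (F i)"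
  let ?A = "\<lambda>i. {\<omega> \<in> PiE (F i) (\<lambda>_. UNIV). Q i {e \<in> F i. \<omega> e}}"
  have ind: "prob_space.indep_vars ?M (\<lambda>i. PiM (F i) (\<lambda>_. count_space UNIV)) ?X I"
    by (rule prob_space.indep_vars_restrict[OF measure_pmf.prob_space_axioms indep_vars_Pi_pmf[OF fin]])
       (use F in auto)
  \<comment> \<open>The restricted variables take values in a product of discrete spaces; as
    \<open>F i\<close> is finite, every subset of that product is measurable.\<close>
  have sets: "?A i \<in> sets (PiM (F i) (\<lambda>_. count_space UNIV))" if "i \<in> I" for i
    by (subst count_space_PiM_finite[OF finF[OF that]]) auto
  have eq: "?X i -` ?A i \<inter> space ?M = {\<omega>. Q i ({e \<in> ?P. \<omega> e} \<inter> F i)}" if "i \<in> I" for i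
  proof -
    have "{e \<in> F i. restrict \<omega> (F i) e} = {e \<in> ?P. \<omega> e} \<inter> F i" for \<omega>
      using F(1)[OF that] by auto
    then show ?thesis by auto
  qed
  have "measure_pmf.prob ?M (\<Inter>i\<in>I. ?X i -` ?A i \<inter> space ?M) =
      (\<Prod>i\<in>I. measure_pmf.prob ?M (?X i -` ?A i \<inter> space ?M))"
    by (rule prob_space.indep_varsD_finite[OF measure_pmf.prob_space_axioms ind I(2,1) sets])
  also have "(\<Inter>i\<in>I. ?X i -` ?A i \<inter> space ?M) = {\<omega>. \<forall>i\<in>I. Q i ({e \<in> ?P. \<omega> e} \<inter> F i)}"
    using eq I(2) by auto
  also have "(\<Prod>i\<in>I. measure_pmf.prob ?M (?X i -` ?A i \<inter> space ?M)) =
     (\<Prod>i\<in>I. measure_pmf.prob ?M {\<omega>. Q i ({e \<in> ?P. \<omega> e} \<inter> F i)})"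
    using eq by (intro prod.cong) auto
  finally show ?thesis
    using prob_gnp[of n p "\<lambda>E. \<forall>i\<in>I. Q i (E \<inter> F i)"] prob_gnp[of n p "\<lambda>E. Q i (E \<inter> F i)" for i]
    by simp
qed

text \<open>The predicate does not take n as an argument: it can read it off the graph as
  \<open>card (verts G)\<close>.\<close>

definition whp :: "real \<Rightarrow> (nat graph \<Rightarrow> bool) \<Rightarrow> bool" where
  "whp \<alpha> Q \<longleftrightarrow> (\<lambda>n. measure_pmf.prob (gnp n (real n powr (-\<alpha>))) {G. \<not> Q G}) \<longlonglongrightarrow> 0"

lemma whpI_bound:
  assumes "\<forall>\<^sub>F n in sequentially. measure_pmf.prob (gnp n (real n powr (-\<alpha>))) {G. \<not> Q G} \<le> b n"
    and "b \<longlonglongrightarrow> 0"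
  shows "whp \<alpha> Q"
  unfolding whp_def
  by (rule tendsto_sandwich[OF _ assms(1) tendsto_const assms(2)]) auto

lemma whp_conj:
  assumes "whp \<alpha> P" "whp \<alpha> Q"
  shows "whp \<alpha> (\<lambda>G. P G \<and> Q G)"
proof (rule whpI_bound)
  show "(\<lambda>n. measure_pmf.prob (gnp n (real n powr (-\<alpha>))) {G. \<not> P G}
      + measure_pmf.prob (gnp n (real n powr (-\<alpha>))) {G. \<not> Q G}) \<longlonglongrightarrow> 0"
    using tendsto_add[OF assms[unfolded whp_def]] by simp
  have "{G. \<not> (P G \<and> Q G)} = {G. \<not> P G} \<union> {G. \<not> Q G}" by auto
  then show "\<forall>\<^sub>F n in sequentially. measure_pmf.prob (gnp n (real n powr (-\<alpha>))) {G. \<not> (P G \<and> Q G)}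
     \<le> measure_pmf.prob (gnp n (real n powr (-\<alpha>))) {G. \<not> P G}
      + measure_pmf.prob (gnp n (real n powr (-\<alpha>))) {G. \<not> Q G}"
    by (auto intro!: always_eventually measure_Un_le)
qed

lemma whp_support:
  assumes "\<forall>\<^sub>F n in sequentially. \<forall>G. verts G = {1..n} \<longrightarrow> edges G \<subseteq> vertex_pairs {1..n} \<longrightarrow> Q G"
  shows "whp \<alpha> Q"
proof (rule whpI_bound[where b = "\<lambda>_. 0"])
  show "\<forall>\<^sub>F n in sequentially. measure_pmf.prob (gnp n (real n powr (-\<alpha>))) {G. \<not> Q G} \<le> 0"
    using assms
  proof eventually_elim
    case (elim n)
    then have "set_pmf (gnp n (real n powr (-\<alpha>))) \<inter> {G. \<not> Q G} = {}"
      using gnp_support by blast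
    then have "measure_pmf.prob (gnp n (real n powr (-\<alpha>))) {G. \<not> Q G} = 0"
      by (subst measure_pmf_zero_iff)
    then show ?case by simp
  qed
qed simp

lemma whp_mono: 
  assumes "whp \<alpha> P" "\<And>G. P G \<Longrightarrow> Q G"
  shows "whp \<alpha> Q"
proof (rule whpI_bound)
  show "\<forall>\<^sub>F n in sequentially. measure_pmf.prob (gnp n (real n powr (-\<alpha>))) {G. \<not> Q G}
     \<le> measure_pmf.prob (gnp n (real n powr (-\<alpha>))) {G. \<not> P G}"
    using assms(2) by (intro always_eventually allI measure_pmf.finite_measure_mono) auto
qed (use assms(1) in \<open>simp add: whp_def\<close>)

lemma whp_True: "whp \<alpha> (\<lambda>_. True)"
  by (simp add: whp_def)

lemma whp_ball_finite:
  assumes "finite A" "\<And>x. x \<in> A \<Longrightarrow> whp \<alpha> (Q x)"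
  shows "whp \<alpha> (\<lambda>G. \<forall>x\<in>A. Q x G)"
  using assms
  by (induction A) (auto intro: whp_True whp_conj)

text \<open>An impossible predicate would fail with probability 1 for every n. This lets typical
  graphs be chosen as representatives at the end.\<close>

lemma whp_ex:
  assumes "whp \<alpha> Q" 
  shows "\<exists>G. Q G"
proof (rule ccontr)
  assume "\<not> ?thesis"
  then have "{G. \<not> Q G} = UNIV" by auto
  then have "measure_pmf.prob (gnp n (real n powr (-\<alpha>))) {G. \<not> Q G} = 1" for n
    by simp
  then show False using assms by (simp add: whp_def LIMSEQ_const_iff)
qed

section \<open>Upper bounds on the number of extensions\<close>

text \<open>
  A template \<open>(s, t, E)\<close> describes an extension of \<open>s\<close> roots, with indices in \<open>{..<s}\<close>, by \<open>t\<close> new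
  vertices, with indices in \<open>{s..<s + t}\<close>; \<open>E\<close> contains no edge between roots.
\<close>

definition slots :: "nat \<Rightarrow> nat \<Rightarrow> nat set set" where
  "slots s t = {e. e \<subseteq> {..<s + t} \<and> card e = 2 \<and> \<not> e \<subseteq> {..<s}}"

text \<open>\<open>PiE\<close> makes an extension a finite object, so that extensions can be
  counted; only the first s values of \<open>z\<close> matter.\<close>

definition ext_maps :: "'v set \<Rightarrow> (nat \<Rightarrow> 'v) \<Rightarrow> nat \<Rightarrow> nat \<Rightarrow> (nat \<Rightarrow> 'v) set" where
  "ext_maps V z s t = {y \<in> {..<s + t} \<rightarrow>\<^sub>E V. inj_on y {..<s + t} \<and> (\<forall>i<s. y i = z i)}"

definition edge_image :: "(nat \<Rightarrow> 'v) \<Rightarrow> nat set set \<Rightarrow> 'v set set" where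
  "edge_image y E = (\<lambda>e. y ` e) ` E"

definition copies :: "'v graph \<Rightarrow> (nat \<Rightarrow> 'v) \<Rightarrow> nat \<Rightarrow> nat \<Rightarrow> nat set set \<Rightarrow> (nat \<Rightarrow> 'v) set" where
  "copies G z s t E = {y \<in> ext_maps (verts G) z s t. edge_image y E \<subseteq> edges G}"

definition tweight :: "real \<Rightarrow> nat \<Rightarrow> nat set set \<Rightarrow> nat set \<Rightarrow> real" where
  "tweight \<alpha> s E S = real (card S) - \<alpha> * real (card {e \<in> E. e \<subseteq> {..<s} \<union> S})"

text \<open>The safe extensions of Shelah and Spencer: over fixed roots, the expected number of
  copies of each nonempty part tends to infinity.\<close>

definition safe :: "real \<Rightarrow> nat \<Rightarrow> nat \<Rightarrow> nat set set \<Rightarrow> bool" where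
  "safe \<alpha> s t E \<longleftrightarrow> E \<subseteq> slots s t \<and> (\<forall>S \<subseteq> {s..<s + t}. S \<noteq> {} \<longrightarrow> 0 < tweight \<alpha> s E S)"

lemma finite_slots: "finite (slots s t)"
  by (rule finite_subset[of _ "Pow {..<s + t}"]) (auto simp: slots_def)

lemma finite_slots_subset: "E \<subseteq> slots s t \<Longrightarrow> finite E"
  using finite_slots finite_subset by blast

lemma finite_ext_maps: "finite V \<Longrightarrow> finite (ext_maps V z s t)"
  unfolding ext_maps_def by (rule finite_subset[OF _ finite_PiE[of "{..<s+t}" "\<lambda>_. V"]]) auto

lemma ext_maps_cong: "(\<And>i. i < s \<Longrightarrow> z i = z' i) \<Longrightarrow> ext_maps V z s t = ext_maps V z' s t"
  unfolding ext_maps_def by auto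

lemma copies_cong: "(\<And>i. i < s \<Longrightarrow> z i = z' i) \<Longrightarrow> copies G z s t E = copies G z' s t E"
  unfolding copies_def using ext_maps_cong by metis

lemma finite_copies: "finite (verts G) \<Longrightarrow> finite (copies G z s t E)"
  unfolding copies_def by (simp add: finite_ext_maps)

lemma card_edge_image:
  assumes "inj_on y {..<s + t}" "E \<subseteq> slots s t"
  shows "card (edge_image y E) = card E"
proof -
  have "inj_on (\<lambda>e. y ` e) E"
    using inj_on_image_Pow[OF assms(1)] by (rule inj_on_subset) (use assms(2) in \<open>auto simp: slots_def\<close>)
  then show ?thesis unfolding edge_image_def by (rule card_image)
qed

lemma edge_image_pairs:
  assumes "y \<in> ext_maps V z s t" "E \<subseteq> slots s t"
  shows "edge_image y E \<subseteq> vertex_pairs V"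
proof
  fix d assume "d \<in> edge_image y E"
  then obtain e where e: "e \<in> E" "d = y ` e" by (auto simp: edge_image_def)
  have "e \<subseteq> {..<s + t}" "card e = 2" using e assms(2) by (auto simp: slots_def)
  moreover have "inj_on y {..<s + t}" "y ` {..<s + t} \<subseteq> V" using assms(1) by (auto simp: ext_maps_def)
  ultimately show "d \<in> vertex_pairs V"
    unfolding vertex_pairs_iff e(2) by (metis card_image image_mono inj_on_subset order_trans)
qed

text \<open>\<open>F\<close> lives on \<open>U\<close> and the roots, whereas an edge counted on the
  left has a new endpoint outside \<open>U\<close>; by injectivity its image is not a root either,
  so the edge cannot land in \<open>F\<close>.\<close>

lemma card_new_edges:
  assumes y: "y \<in> ext_maps V z s t" and E: "E \<subseteq> slots s t"
    and F: "F \<subseteq> Pow (U \<union> z ` {..<s})"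
  shows "card {e \<in> E. \<not> e \<subseteq> {..<s} \<union> {i \<in> {s..<s + t}. y i \<in> U}} \<le> card (edge_image y E - F)"
proof -
  let ?E = "{e \<in> E. \<not> e \<subseteq> {..<s} \<union> {i \<in> {s..<s + t}. y i \<in> U}}"
  have inj: "inj_on y {..<s + t}" using y by (simp add: ext_maps_def)
  have "card ?E = card (edge_image y ?E)"
    by (rule card_edge_image[OF inj, symmetric]) (use E in auto)
  also have "\<dots> \<le> card (edge_image y E - F)"
  proof (rule card_mono)
    show "finite (edge_image y E - F)"
      using finite_slots_subset[OF E] by (simp add: edge_image_def)
    show "edge_image y ?E \<subseteq> edge_image y E - F"
    proof
      fix d assume "d \<in> edge_image y ?E"
      then obtain e i where e: "e \<in> E" "d = y ` e" "i \<in> e" "i \<notin> {..<s} \<union> {i \<in> {s..<s + t}. y i \<in> U}"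
        by (auto simp: edge_image_def)
      have i: "i < s + t" "s \<le> i" using e E by (auto simp: slots_def)
      then have "y i \<notin> U" using e(4) by auto
      moreover have "y i \<notin> z ` {..<s}"
      proof
        assume "y i \<in> z ` {..<s}"
        then obtain j where j: "j < s" "y i = z j" by auto
        then have "y i = y j" using y by (auto simp: ext_maps_def)
        then have "i = j" using inj_onD[OF inj] i j by auto
        then show False using i j by simp
      qed
      ultimately have "d \<notin> F" using F e by auto
      then show "d \<in> edge_image y E - F" using e by (auto simp: edge_image_def)
    qed
  qed
  finally show ?thesis .
qed

text \<open>Dropping injectivity leaves a product set: one value at a root, \<open>card U\<close>
  values on \<open>S\<close>, n values elsewhere.\<close>

lemma card_ext_maps_meeting:
  assumes "finite U" "S \<subseteq> {s..<s + t}"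
  shows "card {y \<in> ext_maps {1..n} z s t. {i \<in> {s..<s + t}. y i \<in> U} = S} \<le> card U ^ card S * n ^ (t - card S)"
proof -
  let ?B = "\<lambda>i. if i < s then {z i} else if i \<in> S then U else {1..n}"
  have fS: "finite S" using assms(2) finite_subset by blast
  have "card {y \<in> ext_maps {1..n} z s t. {i \<in> {s..<s + t}. y i \<in> U} = S} \<le> card (PiE {..<s + t} ?B)"
    by (rule card_mono[OF finite_PiE]) (use assms in \<open>auto simp: ext_maps_def PiE_def Pi_def\<close>)
  also have "\<dots> = (\<Prod>i<s + t. card (?B i))" by (simp add: card_PiE)
  also have "\<dots> = (\<Prod>i\<in>{..<s} \<union> (S \<union> ({s..<s + t} - S)). card (?B i))"
    by (rule prod.cong) (use assms in auto)
  also have "\<dots> = (\<Prod>i\<in>{..<s}. card (?B i)) * ((\<Prod>i\<in>S. card (?B i)) * (\<Prod>i\<in>{s..<s + t} - S. card (?B i)))"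
    using assms fS by (subst prod.union_disjoint, (auto)[3], subst prod.union_disjoint) (auto simp: subset_iff)
  also have "(\<Prod>i\<in>{..<s}. card (?B i)) = 1" by simp
  also have "(\<Prod>i\<in>S. card (?B i)) = card U ^ card S"
    using assms(2) by (subst prod.cong[where h = "\<lambda>_. card U" and B = S]) (auto simp: subset_iff)
  also have "(\<Prod>i\<in>{s..<s + t} - S. card (?B i)) = n ^ (t - card S)"
    using assms(2) fS by (subst prod.cong[where h = "\<lambda>_. n" and B = "{s..<s + t} - S"]) (auto simp: card_Diff_subset)
  finally show ?thesis by simp
qed

text \<open>Once the vertices of \<open>S\<close> are placed, t - |S| vertices are free and the
  edges not spanned by \<open>S\<close> and the roots are still required; what remains is the total
  weight minus that of \<open>S\<close>.\<close>

lemma powr_eq_weight: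
  assumes "n \<ge> 1" "S \<subseteq> {s..<s + t}" "E \<subseteq> slots s t"
  shows "real n ^ (t - card S) * (real n powr (-\<alpha>)) ^ card {e \<in> E. \<not> e \<subseteq> {..<s} \<union> S}
       = real n powr (real t - \<alpha> * real (card E) - tweight \<alpha> s E S)"
proof -
  have "card S \<le> t" using card_mono[OF _ assms(2)] by simp
  moreover have "card {e \<in> E. \<not> e \<subseteq> {..<s} \<union> S} + card {e \<in> E. e \<subseteq> {..<s} \<union> S} = card E"
    using finite_slots_subset[OF assms(3)]
    by (subst card_Un_disjoint[symmetric]) (auto intro: arg_cong[where f = card])
  then have "real (card E) = real (card {e \<in> E. \<not> e \<subseteq> {..<s} \<union> S}) + real (card {e \<in> E. e \<subseteq> {..<s} \<union> S})"
    by linarith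
  ultimately show ?thesis
    using assms(1)
    by (simp add: tweight_def powr_realpow[symmetric] powr_powr powr_add[symmetric] of_nat_diff algebra_simps)
qed

text \<open>Common core of the moment estimates. The sum is split by the set \<open>S\<close> of
  indices that land in \<open>U\<close>: at most 2^t sets, each with at most m^t * n^(t - |S|) maps.
  The high moments use all \<open>S\<close> with \<eta> = 0, the variance only nonempty
  \<open>S\<close> with their least weight.\<close>

lemma sum_meeting_le:
  assumes n: "n \<ge> 1" and al: "0 < \<alpha>" and E: "E \<subseteq> slots s t" and Y: "Y \<subseteq> ext_maps {1..n} z s t"
    and U: "finite U" "card U \<le> m" "1 \<le> m" and F: "F \<subseteq> Pow (U \<union> z ` {..<s})"
    and \<S>: "\<And>S. S \<in> \<S> \<Longrightarrow> \<eta> \<le> tweight \<alpha> s E S" "\<S> \<subseteq> Pow {s..<s + t}"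
  shows "(\<Sum>y | y \<in> Y \<and> {i \<in> {s..<s + t}. y i \<in> U} \<in> \<S>. (real n powr (-\<alpha>)) ^ card (edge_image y E - F))
      \<le> 2 ^ t * real m ^ t * real n powr (real t - \<alpha> * real (card E) - \<eta>)"
proof -
  let ?p = "real n powr (-\<alpha>)" and ?S = "\<lambda>y. {i \<in> {s..<s + t}. y i \<in> U}"
  let ?w = "real t - \<alpha> * real (card E)"
  have p: "0 < ?p" "?p \<le> 1" using n al by (auto simp: powr_minus powr_le_one_le ge_one_powr_ge_zero inverse_le_1_iff)
  have finY: "finite Y" using Y finite_ext_maps[of "{1..n}"] finite_subset by blast
  have fin\<S>: "finite \<S>" using \<S>(2) finite_subset by blast
  have "(\<Sum>y | y \<in> Y \<and> ?S y \<in> \<S>. ?p ^ card (edge_image y E - F))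
     \<le> (\<Sum>y | y \<in> Y \<and> ?S y \<in> \<S>. ?p ^ card {e \<in> E. \<not> e \<subseteq> {..<s} \<union> ?S y})"
    by (intro sum_mono power_decreasing card_new_edges[OF _ E F]) (use Y p in auto)
  also have "\<dots> = (\<Sum>S\<in>\<S>. \<Sum>y | y \<in> {y \<in> Y. ?S y \<in> \<S>} \<and> ?S y = S. ?p ^ card {e \<in> E. \<not> e \<subseteq> {..<s} \<union> ?S y})"
    by (rule sum.group[symmetric]) (use finY fin\<S> in auto)
  also have "\<dots> \<le> (\<Sum>S\<in>\<S>. real m ^ t * real n powr (?w - \<eta>))"
  proof (rule sum_mono)
    fix S assume S: "S \<in> \<S>"
    then have S': "S \<subseteq> {s..<s + t}" using \<S>(2) by auto
    then have cS: "card S \<le> t" using card_mono[OF _ S'] by simp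
    have "(\<Sum>y | y \<in> {y \<in> Y. ?S y \<in> \<S>} \<and> ?S y = S. ?p ^ card {e \<in> E. \<not> e \<subseteq> {..<s} \<union> ?S y})
       = (\<Sum>y | y \<in> {y \<in> Y. ?S y \<in> \<S>} \<and> ?S y = S. ?p ^ card {e \<in> E. \<not> e \<subseteq> {..<s} \<union> S})"
      by (rule sum.cong) auto
    also have "\<dots> = real (card {y. y \<in> {y \<in> Y. ?S y \<in> \<S>} \<and> ?S y = S}) * ?p ^ card {e \<in> E. \<not> e \<subseteq> {..<s} \<union> S}"
      by simp
    also have "\<dots> \<le> real (card U ^ card S * n ^ (t - card S)) * ?p ^ card {e \<in> E. \<not> e \<subseteq> {..<s} \<union> S}"
    proof (rule mult_right_mono)
      have "card {y. y \<in> {y \<in> Y. ?S y \<in> \<S>} \<and> ?S y = S} \<le> card {y \<in> ext_maps {1..n} z s t. ?S y = S}"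
        by (rule card_mono) (use Y finite_ext_maps[of "{1..n}"] in auto)
      also have "\<dots> \<le> card U ^ card S * n ^ (t - card S)"
        by (rule card_ext_maps_meeting[OF U(1) S'])
      finally show "real (card {y. y \<in> {y \<in> Y. ?S y \<in> \<S>} \<and> ?S y = S}) \<le> real (card U ^ card S * n ^ (t - card S))"
        using of_nat_mono by blast
    qed simp
    also have "\<dots> = real (card U) ^ card S * (real n ^ (t - card S) * ?p ^ card {e \<in> E. \<not> e \<subseteq> {..<s} \<union> S})"
      by simp
    also have "\<dots> = real (card U) ^ card S * real n powr (?w - tweight \<alpha> s E S)"
      by (subst powr_eq_weight[OF n S' E]) simp
    also have "\<dots> \<le> real m ^ t * real n powr (?w - \<eta>)"
    proof (rule mult_mono)
      have "real (card U) ^ card S \<le> real m ^ card S" using U by (intro power_mono) auto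
      also have "\<dots> \<le> real m ^ t" using U cS by (intro power_increasing) auto
      finally show "real (card U) ^ card S \<le> real m ^ t" .
      show "real n powr (?w - tweight \<alpha> s E S) \<le> real n powr (?w - \<eta>)"
        using n \<S>(1)[OF S] by (intro powr_mono) auto
    qed auto
    finally show "(\<Sum>y | y \<in> {y \<in> Y. ?S y \<in> \<S>} \<and> ?S y = S. ?p ^ card {e \<in> E. \<not> e \<subseteq> {..<s} \<union> ?S y})
        \<le> real m ^ t * real n powr (?w - \<eta>)" .
  qed
  also have "\<dots> = real (card \<S>) * (real m ^ t * real n powr (?w - \<eta>))" by simp
  also have "\<dots> \<le> 2 ^ t * (real m ^ t * real n powr (?w - \<eta>))"
  proof (rule mult_right_mono)
    have "card \<S> \<le> card (Pow {s..<s + t})" by (rule card_mono) (use \<S>(2) in auto)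
    then have "card \<S> \<le> 2 ^ t" by (simp add: card_Pow)
    then show "real (card \<S>) \<le> 2 ^ t" using of_nat_mono by fastforce
  qed simp
  finally show ?thesis by (simp add: mult.assoc)
qed

lemma expectation_of_bool: 
  "measure_pmf.expectation M (\<lambda>x. of_bool (P x) :: real) = measure_pmf.prob M {x. P x}"
proof -
  have "(\<lambda>x. of_bool (P x) :: real) = indicator {x. P x}" by (auto simp: indicator_def)
  then show ?thesis by simp
qed

text \<open>
  The copies in a \<open>T\<close>-tuple are added one at a time. A copy meeting the vertices \<open>U\<close> already used
  exactly in the indices \<open>S\<close> contributes \<open>n\<close> to the power (total weight) minus (weight of \<open>S\<close>), and
  the latter is nonnegative by safety.
\<close>

lemma moment_bound:
  assumes n: "n \<ge> 1" and al: "0 < \<alpha>" and safe: "safe \<alpha> s t E" and Y: "Y \<subseteq> ext_maps {1..n} z s t"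
    and "finite U" "card U \<le> m" "F \<subseteq> Pow (U \<union> z ` {..<s})" "F \<subseteq> vertex_pairs {1..n}"
  shows "measure_pmf.expectation (gnp n (real n powr (-\<alpha>)))
      (\<lambda>G. of_bool (F \<subseteq> edges G) * real (card {y \<in> Y. edge_image y E \<subseteq> edges G}) ^ T)
    \<le> (real n powr (-\<alpha>)) ^ card F *
       (2 ^ t * real (m + t * T + 1) ^ t * real n powr (real t - \<alpha> * real (card E))) ^ T"
  using assms(5-)
\<comment> \<open>\<open>F\<close> collects the edges already required and \<open>U\<close> the
  non-root vertices already used; both grow in the induction.\<close>
proof (induction T arbitrary: F U m)
  case 0
  let ?p = "real n powr (-\<alpha>)"
  have p: "0 \<le> ?p" "?p \<le> 1" using n al by (auto simp: powr_minus ge_one_powr_ge_zero inverse_le_1_iff)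
  show ?case using prob_gnp_superset[OF p 0(4)] by (simp add: expectation_of_bool)
next
  case (Suc T)
  let ?p = "real n powr (-\<alpha>)" and ?w = "real t - \<alpha> * real (card E)"
  let ?M = "measure_pmf (gnp n (real n powr (-\<alpha>)))"
  let ?N = "\<lambda>G. real (card {y \<in> Y. edge_image y E \<subseteq> edges G})"
  let ?B = "2 ^ t * real (m + t * Suc T + 1) ^ t * real n powr ?w"
  have E: "E \<subseteq> slots s t" using safe by (simp add: safe_def)
  have finY: "finite Y" using Y finite_ext_maps[of "{1..n}"] finite_subset by blast
  have finF: "finite F" using Suc.prems(4) finite_vertex_pairs[of "{1..n}"] finite_subset by blast
  have finE: "finite (edge_image y E)" for y using finite_slots_subset[OF E] by (simp add: edge_image_def)
  have N: "?N G = (\<Sum>y\<in>Y. of_bool (edge_image y E \<subseteq> edges G))" for G :: "nat graph"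
    using finY by (simp add: Int_def)
  \<comment> \<open>One factor of the power is expanded over the copies \<open>y\<close>, and the
    presence of \<open>y\<close> is absorbed into \<open>F\<close>.\<close>
  have "of_bool (F \<subseteq> edges G) * ?N G ^ Suc T =
      (\<Sum>y\<in>Y. of_bool (F \<union> edge_image y E \<subseteq> edges G) * ?N G ^ T)" for G :: "nat graph"
  proof -
    have "of_bool (F \<subseteq> edges G) * ?N G ^ Suc T = of_bool (F \<subseteq> edges G) * ?N G * ?N G ^ T" by simp
    also have "of_bool (F \<subseteq> edges G) * ?N G = (\<Sum>y\<in>Y. of_bool (F \<union> edge_image y E \<subseteq> edges G))"
      unfolding N sum_distrib_left by (rule sum.cong) auto
    finally show ?thesis by (simp add: sum_distrib_right)
  qed
  then have "integral\<^sup>L ?M (\<lambda>G. of_bool (F \<subseteq> edges G) * ?N G ^ Suc T) =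
      (\<Sum>y\<in>Y. integral\<^sup>L ?M (\<lambda>G. of_bool (F \<union> edge_image y E \<subseteq> edges G) * ?N G ^ T))"
    by (simp only:) (rule Bochner_Integration.integral_sum, rule integrable_gnp)
  also have "\<dots> \<le> (\<Sum>y\<in>Y. ?p ^ card (F \<union> edge_image y E) * ?B ^ T)"
  proof (rule sum_mono)
    fix y assume "y \<in> Y"
    then have y: "y \<in> ext_maps {1..n} z s t" using Y by auto
    have "integral\<^sup>L ?M (\<lambda>G. of_bool (F \<union> edge_image y E \<subseteq> edges G) * ?N G ^ T)
       \<le> ?p ^ card (F \<union> edge_image y E) * (2 ^ t * real (m + t + t * T + 1) ^ t * real n powr ?w) ^ T"
    \<comment> \<open>The new copy adds at most t vertices, so m grows by t while t * T shrinks by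
      t: the constant is the same at every stage.\<close>
    proof (rule Suc.IH)
      show "finite (U \<union> y ` {s..<s + t})" using Suc.prems by simp
      have "card (U \<union> y ` {s..<s + t}) \<le> card U + card (y ` {s..<s + t})" by (rule card_Un_le)
      also have "\<dots> \<le> m + t" using Suc.prems card_image_le[of "{s..<s + t}" y] by simp
      finally show "card (U \<union> y ` {s..<s + t}) \<le> m + t" .
      have "y ` e \<subseteq> U \<union> y ` {s..<s + t} \<union> z ` {..<s}" if "e \<in> E" for e
      proof -
        have "e \<subseteq> {..<s} \<union> {s..<s + t}" using that E ivl_disj_un_one(2)[of s "s + t"] by (auto simp: slots_def)
        moreover have "y ` {..<s} = z ` {..<s}" using y by (auto simp: ext_maps_def)
        ultimately show ?thesis by blast
      qed
      then show "F \<union> edge_image y E \<subseteq> Pow (U \<union> y ` {s..<s + t} \<union> z ` {..<s})"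
        using Suc.prems(3) by (auto simp: edge_image_def)
      show "F \<union> edge_image y E \<subseteq> vertex_pairs {1..n}"
        using Suc.prems(4) edge_image_pairs[OF y E] by simp
    qed
    then show "integral\<^sup>L ?M (\<lambda>G. of_bool (F \<union> edge_image y E \<subseteq> edges G) * ?N G ^ T)
       \<le> ?p ^ card (F \<union> edge_image y E) * ?B ^ T" by (simp add: add.assoc)
  qed
  also have "\<dots> = ?p ^ card F * ?B ^ T * (\<Sum>y\<in>Y. ?p ^ card (edge_image y E - F))"
  proof -
    have "card (F \<union> edge_image y E) = card F + card (edge_image y E - F)" for y
      using card_Un_disjoint[of F "edge_image y E - F"] finF finE[of y] by auto
    then have "?p ^ card (F \<union> edge_image y E) * ?B ^ T
        = ?p ^ card F * ?B ^ T * ?p ^ card (edge_image y E - F)" for y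
      by (simp only: power_add mult_ac)
    then show ?thesis by (simp only: sum_distrib_left)
  qed
  also have "\<dots> \<le> ?p ^ card F * ?B ^ T * ?B"
  proof (rule mult_left_mono)
    have "(\<Sum>y\<in>Y. ?p ^ card (edge_image y E - F)) =
      (\<Sum>y | y \<in> Y \<and> {i \<in> {s..<s + t}. y i \<in> U} \<in> Pow {s..<s + t}. ?p ^ card (edge_image y E - F))"
      by (rule sum.cong) auto
    also have "\<dots> \<le> 2 ^ t * real (m + t * Suc T + 1) ^ t * real n powr (?w - 0)"
    proof (rule sum_meeting_le[OF n al E Y Suc.prems(1) _ _ Suc.prems(3)])
      show "card U \<le> m + t * Suc T + 1" using Suc.prems(2) by simp
      show "0 \<le> tweight \<alpha> s E S" if "S \<in> Pow {s..<s + t}" for S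
      \<comment> \<open>Safety speaks of nonempty sets only; the empty set has weight 0 because
        \<open>E\<close> has no edge between roots.\<close>
      proof (cases "S = {}")
        case True
        have "{e \<in> E. e \<subseteq> {..<s} \<union> S} = {}" using True E by (auto simp: slots_def)
        then show ?thesis by (simp only: tweight_def) simp
      next
        case False
        then show ?thesis using safe that by (force simp: safe_def less_imp_le)
      qed
    qed auto
    finally show "(\<Sum>y\<in>Y. ?p ^ card (edge_image y E - F)) \<le> ?B" by simp
  qed simp
  finally show ?case by (simp only: power_Suc mult_ac)
qed

text \<open>Union bound over at most n^s choices of roots, which \<open>b\<close> has to beat.
  Congruence in \<open>z\<close> cuts the infinitely many maps down to the extensional ones.\<close>

lemma whp_all_maps:
  assumes cong: "\<And>z z' G. (\<And>i. i < s \<Longrightarrow> z i = z' i) \<Longrightarrow> Q z G \<Longrightarrow> Q z' G"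
    and bound: "\<forall>\<^sub>F n in sequentially. \<forall>z. inj_on z {..<s} \<longrightarrow> z ` {..<s} \<subseteq> {1..n} \<longrightarrow>
       measure_pmf.prob (gnp n (real n powr (-\<alpha>))) {G. \<not> Q z G \<and> verts G = {1..n}} \<le> b n"
    and b: "\<And>n. 0 \<le> b n" and lim: "(\<lambda>n. real n ^ s * b n) \<longlonglongrightarrow> 0"
  shows "whp \<alpha> (\<lambda>G. \<forall>z. inj_on z {..<s} \<longrightarrow> z ` {..<s} \<subseteq> verts G \<longrightarrow> Q z G)"
proof (rule whpI_bound[OF _ lim])
  show "\<forall>\<^sub>F n in sequentially. measure_pmf.prob (gnp n (real n powr (-\<alpha>)))
      {G. \<not> (\<forall>z. inj_on z {..<s} \<longrightarrow> z ` {..<s} \<subseteq> verts G \<longrightarrow> Q z G)} \<le> real n ^ s * b n"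
    using bound
  proof eventually_elim
    case (elim n)
    let ?M = "gnp n (real n powr (-\<alpha>))"
    let ?bad = "{G. \<not> (\<forall>z. inj_on z {..<s} \<longrightarrow> z ` {..<s} \<subseteq> verts G \<longrightarrow> Q z G)}"
    let ?Z = "{z \<in> {..<s} \<rightarrow>\<^sub>E {1..n}. inj_on z {..<s}}"
    have finZ: "finite ?Z" by (simp add: finite_PiE)
    have "measure_pmf.prob ?M ?bad = measure_pmf.prob ?M (?bad \<inter> set_pmf ?M)"
      by (simp add: measure_Int_set_pmf)
    also have "\<dots> \<le> measure_pmf.prob ?M (\<Union>z\<in>?Z. {G. \<not> Q z G \<and> verts G = {1..n}})"
    proof (rule measure_pmf.finite_measure_mono)
      show "?bad \<inter> set_pmf ?M \<subseteq> (\<Union>z\<in>?Z. {G. \<not> Q z G \<and> verts G = {1..n}})"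
      proof
        fix G assume G: "G \<in> ?bad \<inter> set_pmf ?M"
        then have V: "verts G = {1..n}" using gnp_support by blast
        obtain z where z: "inj_on z {..<s}" "z ` {..<s} \<subseteq> verts G" "\<not> Q z G" using G by auto
        have "\<not> Q (restrict z {..<s}) G" using z(3) cong[of "restrict z {..<s}" z G] by auto
        moreover have "restrict z {..<s} \<in> ?Z" using z V by (auto simp: inj_on_def)
        ultimately show "G \<in> (\<Union>z\<in>?Z. {G. \<not> Q z G \<and> verts G = {1..n}})" using V by blast
      qed
    qed simp
    also have "\<dots> \<le> (\<Sum>z\<in>?Z. measure_pmf.prob ?M {G. \<not> Q z G \<and> verts G = {1..n}})"
      by (rule measure_UNION_le[OF finZ]) auto
    also have "\<dots> \<le> (\<Sum>z\<in>?Z. b n)"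
      by (intro sum_mono) (use elim in auto)
    also have "\<dots> = real (card ?Z) * b n" by simp
    also have "\<dots> \<le> real n ^ s * b n"
    proof (rule mult_right_mono)
      show "0 \<le> b n" by (rule b)
      have "card ?Z \<le> n ^ s"
      proof -
        have "card ?Z \<le> card ({..<s} \<rightarrow>\<^sub>E {1..n})" by (rule card_mono) (auto simp: finite_PiE)
        then show ?thesis by (simp add: card_PiE)
      qed
      then show "real (card ?Z) \<le> real n ^ s" by (metis of_nat_mono of_nat_power)
    qed
    finally show ?case .
  qed
qed

lemma tendsto_powr_neg_0:
  assumes "a < 0"
  shows "(\<lambda>n. c * real n powr a) \<longlonglongrightarrow> 0"
  using tendsto_mult_left[OF tendsto_neg_powr[OF assms filterlim_real_sequentially]] by simp

lemma whp_copies_le: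
  assumes al: "0 < \<alpha>" and safe: "safe \<alpha> s t E" and w: "real t - \<alpha> * real (card E) < w" and \<xi>: "0 < \<xi>"
  shows "whp \<alpha> (\<lambda>G. \<forall>z. inj_on z {..<s} \<longrightarrow> z ` {..<s} \<subseteq> verts G \<longrightarrow>
     real (card (copies G z s t E)) \<le> \<xi> * real (card (verts G)) powr w)"
proof -
  let ?w = "real t - \<alpha> * real (card E)"
  \<comment> \<open>By Markov's inequality for the T-th moment, the bound for fixed roots fails with
    probability of order n powr (-T * (w - ?w)); \<open>T\<close> is chosen to beat n^s.\<close>
  obtain T :: nat where T: "real s / (w - ?w) < real T" using reals_Archimedean2 by blast
  then have T': "real s < real T * (w - ?w)" using w by (simp add: pos_divide_less_eq)
  let ?C = "2 ^ t * real (0 + t * T + 1) ^ t"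
  show ?thesis
  proof (rule whp_all_maps)
    show "real (card (copies G z' s t E)) \<le> \<xi> * real (card (verts G)) powr w"
      if "\<And>i. i < s \<Longrightarrow> z i = z' i" "real (card (copies G z s t E)) \<le> \<xi> * real (card (verts G)) powr w"
      for z z' :: "nat \<Rightarrow> nat" and G
      using that copies_cong[of s z z'] by simp
    let ?b = "\<lambda>n. (?C * real n powr ?w / (\<xi> * real n powr w)) ^ T"
    show "\<forall>\<^sub>F n in sequentially. \<forall>z. inj_on z {..<s} \<longrightarrow> z ` {..<s} \<subseteq> {1..n} \<longrightarrow>
       measure_pmf.prob (gnp n (real n powr - \<alpha>))
         {G. \<not> real (card (copies G z s t E)) \<le> \<xi> * real (card (verts G)) powr w \<and> verts G = {1..n}} \<le> ?b n"
      using eventually_ge_at_top[of 1]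
    proof eventually_elim
      case (elim n)
      show ?case
      proof (intro allI impI)
        fix z :: "nat \<Rightarrow> nat"
        let ?Y = "ext_maps {1..n} z s t"
        let ?N = "\<lambda>G :: nat graph. real (card {y \<in> ?Y. edge_image y E \<subseteq> edges G})"
        let ?M = "gnp n (real n powr - \<alpha>)"
        let ?a = "\<xi> * real n powr w"
        have a: "0 < ?a" using elim \<xi> by simp
        have "measure_pmf.prob ?M {G. \<not> real (card (copies G z s t E)) \<le> \<xi> * real (card (verts G)) powr w \<and> verts G = {1..n}}
           \<le> measure_pmf.prob ?M {G. ?a < ?N G}"
          by (rule measure_pmf.finite_measure_mono) (auto simp: copies_def)
        also have "\<dots> = measure_pmf.expectation ?M (\<lambda>G. of_bool (?a < ?N G))"
          by (simp add: expectation_of_bool)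
        \<comment> \<open>The factor with the empty set is 1; it gives the shape of
          \<open>moment_bound\<close> with no edge required beforehand.\<close>
        also have "\<dots> \<le> measure_pmf.expectation ?M (\<lambda>G. of_bool ({} \<subseteq> edges G) * ?N G ^ T / ?a ^ T)"
          by (intro integral_mono integrable_gnp)
             (use a in \<open>auto simp: of_bool_def intro!: power_mono\<close>)
        also have "\<dots> = measure_pmf.expectation ?M (\<lambda>G. of_bool ({} \<subseteq> edges G) * ?N G ^ T) / ?a ^ T"
          by simp
        also have "\<dots> \<le> ((real n powr (-\<alpha>)) ^ card ({} :: nat set set) * (?C * real n powr ?w) ^ T) / ?a ^ T"
          by (rule divide_right_mono, rule moment_bound[where U = "{}"]) (use elim al safe a in auto)
        also have "\<dots> = ?b n" by (simp add: power_divide)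
        finally show "measure_pmf.prob ?M {G. \<not> real (card (copies G z s t E)) \<le> \<xi> * real (card (verts G)) powr w \<and> verts G = {1..n}}
           \<le> ?b n" .
      qed
    qed
    show "0 \<le> ?b n" for n using \<xi> by simp
    have "\<forall>\<^sub>F n in sequentially. real n ^ s * ?b n = (?C / \<xi>) ^ T * real n powr (real s - real T * (w - ?w))"
      using eventually_gt_at_top[of 0]
    proof eventually_elim
      case (elim n)
      have "?b n = (?C / \<xi> * real n powr (?w - w)) ^ T" using elim \<xi> by (simp add: powr_diff mult_ac)
      also have "\<dots> = (?C / \<xi>) ^ T * real n powr (real T * (?w - w))"
        using elim by (simp only: power_mult_distrib) (simp add: powr_power mult.commute)
      finally have "real n ^ s * ?b n = (?C / \<xi>) ^ T * (real n powr real s * real n powr (real T * (?w - w)))"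
        using elim by (simp only: powr_realpow[symmetric, of "real n" s]) (simp add: powr_realpow)
      then show ?case by (simp only: powr_add[symmetric]) (simp add: algebra_simps)
    qed
    then show "(\<lambda>n. real n ^ s * ?b n) \<longlonglongrightarrow> 0"
      by (subst tendsto_cong) (auto intro!: tendsto_powr_neg_0 simp del: of_nat_add of_nat_mult add_0 simp: T')
  qed
qed

section \<open>Lower bounds on the number of extensions\<close>

text \<open>Chebyshev's inequality with mean \<mu>. Pairs of copies without common new vertex
  contribute at most \<mu>^2 to the second moment, overlapping pairs at most \<mu> *
  \<open>?K\<close>, which therefore bounds the variance. \<open>Y\<close> is left free so that it
  can be confined to blocks.\<close>

lemma prob_copies_small:
  assumes n: "n \<ge> 1" and al: "0 < \<alpha>" and E: "E \<subseteq> slots s t" and Y: "Y \<subseteq> ext_maps {1..n} z s t"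
    and \<eta>: "\<And>S. S \<subseteq> {s..<s + t} \<Longrightarrow> S \<noteq> {} \<Longrightarrow> \<eta> \<le> tweight \<alpha> s E S"
    and \<mu>: "\<mu> = real (card Y) * (real n powr (-\<alpha>)) ^ card E" "0 < \<mu>"
  shows "measure_pmf.prob (gnp n (real n powr (-\<alpha>)))
      {G. real (card {y \<in> Y. edge_image y E \<subseteq> edges G}) < \<mu> / 2}
    \<le> 4 * (2 ^ t * real (t + 1) ^ t * real n powr (real t - \<alpha> * real (card E) - \<eta>)) / \<mu>"
proof -
  let ?p = "real n powr (-\<alpha>)" and ?M = "measure_pmf (gnp n (real n powr (-\<alpha>)))"
  let ?N = "\<lambda>G :: nat graph. real (card {y \<in> Y. edge_image y E \<subseteq> edges G})"
  let ?K = "2 ^ t * real (t + 1) ^ t * real n powr (real t - \<alpha> * real (card E) - \<eta>)"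
  have p: "0 \<le> ?p" "?p \<le> 1" using n al by (auto simp: powr_minus ge_one_powr_ge_zero inverse_le_1_iff)
  have finY: "finite Y" using Y finite_ext_maps[of "{1..n}"] finite_subset by blast
  have finE: "finite (edge_image y E)" for y using finite_slots_subset[OF E] by (simp add: edge_image_def)
  have cE: "card (edge_image y E) = card E" if "y \<in> Y" for y
    using Y that by (intro card_edge_image[OF _ E]) (auto simp: ext_maps_def)
  have pairs: "edge_image y E \<subseteq> vertex_pairs {1..n}" if "y \<in> Y" for y
    by (rule edge_image_pairs[OF _ E]) (use Y that in auto)
  have N: "?N G = (\<Sum>y\<in>Y. of_bool (edge_image y E \<subseteq> edges G))" for G
    using finY by (simp add: Int_def)
  have EN: "integral\<^sup>L ?M ?N = \<mu>"
  proof -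
    have "integral\<^sup>L ?M ?N = (\<Sum>y\<in>Y. integral\<^sup>L ?M (\<lambda>G. of_bool (edge_image y E \<subseteq> edges G)))"
      unfolding N by (rule Bochner_Integration.integral_sum, rule integrable_gnp)
    also have "\<dots> = (\<Sum>y\<in>Y. ?p ^ card E)"
      by (intro sum.cong refl) (simp add: expectation_of_bool prob_gnp_superset[OF p pairs] cE)
    finally show ?thesis by (simp add: \<mu>)
  qed
  have inner: "(\<Sum>y'\<in>Y. ?p ^ card (edge_image y E \<union> edge_image y' E)) \<le> ?p ^ card E * (\<mu> + ?K)" if y: "y \<in> Y" for y
  proof -
    let ?U = "y ` {s..<s + t}" and ?F = "edge_image y E"
    let ?S = "\<lambda>y'. {i \<in> {s..<s + t}. y' i \<in> ?U}"
    have ye: "y ` e \<subseteq> ?U \<union> z ` {..<s}" if "e \<in> E" for e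
    proof -
      have "e \<subseteq> {..<s} \<union> {s..<s + t}" using that E ivl_disj_un_one(2)[of s "s + t"] by (auto simp: slots_def)
      moreover have "y ` {..<s} = z ` {..<s}" using y Y by (auto simp: ext_maps_def)
      ultimately show ?thesis by blast
    qed
    then have F: "?F \<subseteq> Pow (?U \<union> z ` {..<s})" by (auto simp: edge_image_def)
    have "(\<Sum>y'\<in>Y. ?p ^ card (?F \<union> edge_image y' E)) = ?p ^ card E * (\<Sum>y'\<in>Y. ?p ^ card (edge_image y' E - ?F))"
    proof -
      have "card (?F \<union> edge_image y' E) = card E + card (edge_image y' E - ?F)" for y'
        using card_Un_disjoint[of ?F "edge_image y' E - ?F"] finE cE[OF y] by auto
      then show ?thesis by (simp add: power_add sum_distrib_left)
    qed
    also have "(\<Sum>y'\<in>Y. ?p ^ card (edge_image y' E - ?F)) =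
       (\<Sum>y'\<in>{y' \<in> Y. ?S y' = {}} \<union> {y' \<in> Y. ?S y' \<in> Pow {s..<s+t} - {{}}}. ?p ^ card (edge_image y' E - ?F))"
      by (rule sum.cong) auto
    also have "\<dots> = (\<Sum>y' | y' \<in> Y \<and> ?S y' = {}. ?p ^ card (edge_image y' E - ?F)) +
       (\<Sum>y' | y' \<in> Y \<and> ?S y' \<in> Pow {s..<s+t} - {{}}. ?p ^ card (edge_image y' E - ?F))"
      by (rule sum.union_disjoint) (use finY in auto)
    also have "(\<Sum>y' | y' \<in> Y \<and> ?S y' \<in> Pow {s..<s+t} - {{}}. ?p ^ card (edge_image y' E - ?F)) \<le> ?K"
      by (rule sum_meeting_le[OF n al E Y _ _ _ F])
         (use \<eta> card_image_le[of "{s..<s+t}" y] in auto)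
    also have "(\<Sum>y' | y' \<in> Y \<and> ?S y' = {}. ?p ^ card (edge_image y' E - ?F)) \<le> \<mu>"
    proof -
      have "(\<Sum>y' | y' \<in> Y \<and> ?S y' = {}. ?p ^ card (edge_image y' E - ?F)) \<le> (\<Sum>y' | y' \<in> Y \<and> ?S y' = {}. ?p ^ card E)"
      proof (rule sum_mono)
        fix y' assume y': "y' \<in> {y'. y' \<in> Y \<and> ?S y' = {}}"
        then have "y' \<in> ext_maps {1..n} z s t" using Y by blast
        from card_new_edges[OF this E F] have "card {e \<in> E. \<not> e \<subseteq> {..<s} \<union> ?S y'} \<le> card (edge_image y' E - ?F)" .
        \<comment> \<open>Copies without a common new vertex share no edge, since each edge of
          \<open>E\<close> has a new endpoint.\<close>
        moreover have "{e \<in> E. \<not> e \<subseteq> {..<s} \<union> ?S y'} = E"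
        proof -
          have S: "?S y' = {}" using y' by blast
          show ?thesis unfolding S using E by (auto simp: slots_def)
        qed
        ultimately show "?p ^ card (edge_image y' E - ?F) \<le> ?p ^ card E"
          using p by (intro power_decreasing) auto
      qed
      also have "\<dots> \<le> (\<Sum>y'\<in>Y. ?p ^ card E)" by (rule sum_mono2[OF finY]) (use p in auto)
      finally show ?thesis by (simp add: \<mu>)
    qed
    finally show ?thesis using p by (simp add: mult_left_mono)
  qed
  have "integral\<^sup>L ?M (\<lambda>G. ?N G ^ 2) \<le> \<mu> * (\<mu> + ?K)"
  proof -
    have "?N G ^ 2 = (\<Sum>y\<in>Y. \<Sum>y'\<in>Y. of_bool (edge_image y E \<union> edge_image y' E \<subseteq> edges G))" for G
      unfolding N power2_eq_square sum_product by (intro sum.cong refl) auto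
    then have "integral\<^sup>L ?M (\<lambda>G. ?N G ^ 2) =
       (\<Sum>y\<in>Y. \<Sum>y'\<in>Y. integral\<^sup>L ?M (\<lambda>G. of_bool (edge_image y E \<union> edge_image y' E \<subseteq> edges G)))"
      by (simp only: Bochner_Integration.integral_sum integrable_gnp)
    also have "\<dots> = (\<Sum>y\<in>Y. \<Sum>y'\<in>Y. ?p ^ card (edge_image y E \<union> edge_image y' E))"
    proof (intro sum.cong refl)
      fix y y' assume "y \<in> Y" "y' \<in> Y"
      then have "edge_image y E \<union> edge_image y' E \<subseteq> vertex_pairs {1..n}" using pairs by simp
      from prob_gnp_superset[OF p this]
      show "integral\<^sup>L ?M (\<lambda>G. of_bool (edge_image y E \<union> edge_image y' E \<subseteq> edges G)) = ?p ^ card (edge_image y E \<union> edge_image y' E)"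
        by (simp only: expectation_of_bool)
    qed
    also have "\<dots> \<le> (\<Sum>y\<in>Y. ?p ^ card E * (\<mu> + ?K))" by (rule sum_mono) (rule inner)
    also have "\<dots> = \<mu> * (\<mu> + ?K)" by (simp add: \<mu>(1))
    finally show ?thesis .
  qed
  moreover have "integral\<^sup>L ?M (\<lambda>G. (?N G - \<mu>) ^ 2) = integral\<^sup>L ?M (\<lambda>G. ?N G ^ 2) - \<mu> ^ 2"
  proof -
    have "(?N G - \<mu>) ^ 2 = ?N G ^ 2 - 2 * \<mu> * ?N G + \<mu> ^ 2" for G
      by (simp add: power2_diff)
    then have "integral\<^sup>L ?M (\<lambda>G. (?N G - \<mu>) ^ 2) =
       integral\<^sup>L ?M (\<lambda>G. ?N G ^ 2) - 2 * \<mu> * integral\<^sup>L ?M ?N + \<mu> ^ 2"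
      by (simp add: integrable_gnp Bochner_Integration.integral_add Bochner_Integration.integral_diff)
    then show ?thesis by (simp add: EN power2_eq_square)
  qed
  ultimately have var: "integral\<^sup>L ?M (\<lambda>G. (?N G - \<mu>) ^ 2) \<le> \<mu> * ?K"
    by (simp add: power2_eq_square distrib_left)
  have "measure_pmf.prob (gnp n ?p) {G. ?N G < \<mu> / 2} = integral\<^sup>L ?M (\<lambda>G. of_bool (?N G < \<mu> / 2))"
    by (simp add: expectation_of_bool)
  also have "\<dots> \<le> integral\<^sup>L ?M (\<lambda>G. (?N G - \<mu>) ^ 2 / (\<mu> / 2) ^ 2)"
  proof (intro integral_mono integrable_gnp)
    fix G
    have "(\<mu> / 2) ^ 2 \<le> (\<mu> - ?N G) ^ 2" if "?N G < \<mu> / 2"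
      using that \<mu>(2) by (intro power_mono) auto
    then show "of_bool (?N G < \<mu> / 2) \<le> (?N G - \<mu>) ^ 2 / (\<mu> / 2) ^ 2"
      using \<mu>(2) by (auto simp: power2_commute[of \<mu>] of_bool_def)
  qed
  also have "\<dots> = integral\<^sup>L ?M (\<lambda>G. (?N G - \<mu>) ^ 2) / (\<mu> / 2) ^ 2" by simp
  also have "\<dots> \<le> (\<mu> * ?K) / (\<mu> / 2) ^ 2"
    by (rule divide_right_mono[OF var]) simp
  also have "\<dots> = 4 * ?K / \<mu>" using \<mu>(2) by (simp add: power2_eq_square field_simps)
  finally show ?thesis .
qed

text \<open>Cutting out the roots keeps new vertices away from them; putting different new vertices
  into different blocks then gives injectivity for free.\<close>

definition block :: "nat \<Rightarrow> nat \<Rightarrow> (nat \<Rightarrow> nat) \<Rightarrow> nat \<Rightarrow> nat \<Rightarrow> nat set" where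
  "block n D z s b = {b * (n div D) + 1..(b + 1) * (n div D)} - z ` {..<s}"

lemma block_subset: "b < D \<Longrightarrow> block n D z s b \<subseteq> {1..n}"
proof -
  assume "b < D"
  then have "(b + 1) * (n div D) \<le> D * (n div D)" by (intro mult_right_mono) auto
  also have "\<dots> \<le> n" by simp
  finally show ?thesis by (auto simp: block_def)
qed

lemma block_disjoint:
  assumes "x \<in> block n D z s b" "x \<in> block n D z s b'"
  shows "b = b'"
proof (rule ccontr)
  have *: False if "x \<in> block n D z s b" "x \<in> block n D z s b'" "b < b'" for b b'
  proof -
    have "(b + 1) * (n div D) \<le> b' * (n div D)" using that(3) by (intro mult_right_mono) auto
    then show False using that by (auto simp: block_def)
  qed
  assume "b \<noteq> b'"
  then show False using * assms by (metis nat_neq_iff)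
qed

lemma card_block: "n div D - s \<le> card (block n D z s b)"
proof -
  have "card {b * (n div D) + 1..(b + 1) * (n div D)} - card (z ` {..<s}) \<le> card (block n D z s b)"
    unfolding block_def by (rule diff_card_le_card_Diff) simp
  moreover have "card (z ` {..<s}) \<le> s" using card_image_le[of "{..<s}" z] by simp
  ultimately show ?thesis by (simp add: algebra_simps)
qed

text \<open>
  Chebyshev alone fails with probability \<open>O(n powr -\<eta>)\<close>, which does not survive the union over the
  \<open>n ^ s\<close> choices of roots. Copies with new vertices in \<open>T\<close> disjoint blocks use disjoint sets of
  edges, so this probability gets raised to the power \<open>T\<close>.
\<close>

lemma whp_copies_ge:
  assumes al: "0 < \<alpha>" and safe: "safe \<alpha> s t E" and t: "1 \<le> t"
  shows "\<exists>c>0. whp \<alpha> (\<lambda>G. \<forall>z. inj_on z {..<s} \<longrightarrow> z ` {..<s} \<subseteq> verts G \<longrightarrow>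
     c * real (card (verts G)) powr (real t - \<alpha> * real (card E)) \<le> real (card (copies G z s t E)))"
proof -
  let ?w = "real t - \<alpha> * real (card E)"
  have E: "E \<subseteq> slots s t" using safe by (simp add: safe_def)
  define \<eta> where "\<eta> = Min (insert 1 (tweight \<alpha> s E ` (Pow {s..<s + t} - {{}})))"
  have \<eta>: "\<eta> \<le> tweight \<alpha> s E S" if "S \<subseteq> {s..<s + t}" "S \<noteq> {}" for S
    unfolding \<eta>_def by (rule Min_le) (use that in auto)
  have \<eta>0: "0 < \<eta>"
    unfolding \<eta>_def using safe by (subst Min_gr_iff) (auto simp: safe_def)
  \<comment> \<open>One family of copies is too small with probability of order n powr -\<eta>;
    \<open>T\<close> independent families beat the n^s choices of roots.\<close>
  obtain T :: nat where "real s / \<eta> < real T" using reals_Archimedean2 by blast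
  then have T: "real s < real T * \<eta>" using \<eta>0 by (simp add: pos_divide_less_eq)
  then have T1: "T \<ge> 1" using \<eta>0 by (cases T) auto
  \<comment> \<open>One block for each new vertex of each of the \<open>T\<close> families.\<close>
  define D where "D = T * t"
  have D: "D \<ge> 1" using T1 t by (simp add: D_def)
  \<comment> \<open>Each block will have at least n / (2 * D) vertices, which gives at least c * n^t
    maps in every family.\<close>
  define c where "c = (1 / (2 * real D)) ^ t"
  have c: "0 < c" using D by (simp add: c_def)
  let ?C = "2 ^ t * real (t + 1) ^ t"
  let ?b = "\<lambda>n. (4 * ?C / c * real n powr (-\<eta>)) ^ T"
  have "whp \<alpha> (\<lambda>G. \<forall>z. inj_on z {..<s} \<longrightarrow> z ` {..<s} \<subseteq> verts G \<longrightarrow>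
     c / 2 * real (card (verts G)) powr ?w \<le> real (card (copies G z s t E)))"
  proof (rule whp_all_maps)
    show "c / 2 * real (card (verts G)) powr ?w \<le> real (card (copies G z' s t E))"
      if "\<And>i. i < s \<Longrightarrow> z i = z' i" "c / 2 * real (card (verts G)) powr ?w \<le> real (card (copies G z s t E))"
      for z z' :: "nat \<Rightarrow> nat" and G
      using that copies_cong[of s z z'] by simp
    show "0 \<le> ?b n" for n using c by simp
    have "\<forall>\<^sub>F n in sequentially. real n ^ s * ?b n = (4 * ?C / c) ^ T * real n powr (real s - real T * \<eta>)"
      using eventually_gt_at_top[of 0]
    proof eventually_elim
      case (elim n)
      have "?b n = (4 * ?C / c) ^ T * real n powr (real T * (- \<eta>))"
        using elim by (simp only: power_mult_distrib) (simp add: powr_power mult.commute)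
      then have "real n ^ s * ?b n = (4 * ?C / c) ^ T * (real n powr real s * real n powr (real T * (- \<eta>)))"
        using elim by (simp only: powr_realpow[symmetric, of "real n" s]) (simp add: powr_realpow)
      then show ?case by (simp only: powr_add[symmetric]) (simp add: algebra_simps)
    qed
    then show "(\<lambda>n. real n ^ s * ?b n) \<longlonglongrightarrow> 0"
      by (subst tendsto_cong) (auto intro!: tendsto_powr_neg_0 simp del: of_nat_add of_nat_mult add_0 simp: T)
    show "\<forall>\<^sub>F n in sequentially. \<forall>z. inj_on z {..<s} \<longrightarrow> z ` {..<s} \<subseteq> {1..n} \<longrightarrow>
       measure_pmf.prob (gnp n (real n powr - \<alpha>))
         {G. \<not> c / 2 * real (card (verts G)) powr ?w \<le> real (card (copies G z s t E)) \<and> verts G = {1..n}} \<le> ?b n"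
      using eventually_ge_at_top[of "2 * D * (1 + s)"]
    proof eventually_elim
      case (elim n)
      have "1 \<le> 2 * D * (1 + s)" using D by simp
      then have n1: "n \<ge> 1" using elim by (rule order_trans)
      let ?p = "real n powr (-\<alpha>)"
      have p: "0 < ?p" using n1 by simp
      \<comment> \<open>The threshold makes n / (2 * D) at least 1 + s: this pays for the rounding
        in \<open>n div D\<close> and for the removed roots.\<close>
      have blk: "real n / (2 * real D) \<le> real (card (block n D z s b))" for z b
      proof -
        have "real (2 * D * (1 + s)) \<le> real n" using elim by (rule of_nat_mono)
        then have "1 + real s \<le> real n / (2 * real D)" using D by (simp add: field_simps)
        moreover have "real n / real D - 1 \<le> real (n div D)"
        proof -
          have "n < D * (n div D) + D" using dividend_less_div_times[of D n] D by (simp add: algebra_simps)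
          then have "real n < real D * real (n div D) + real D"
            by (metis of_nat_add of_nat_less_iff of_nat_mult)
          then show ?thesis using D by (simp add: field_simps)
        qed
        moreover have "real (n div D) - real s \<le> real (card (block n D z s b))"
          using of_nat_mono[OF card_block[of n D s z b], where ?'a = real] by linarith
        moreover have "real n / real D = real n / (2 * real D) + real n / (2 * real D)"
          using D by (simp add: field_simps)
        ultimately show ?thesis by linarith
      qed
      show ?case
      proof (intro allI impI)
        fix z :: "nat \<Rightarrow> nat"
        assume z: "inj_on z {..<s}" "z ` {..<s} \<subseteq> {1..n}"
        let ?M = "gnp n ?p"
        \<comment> \<open>The block that holds the vertex with index j in family i; new indices
          start at s.\<close>
        let ?idx = "\<lambda>i j. i * t + (j - s)"
        define Y where "Y = (\<lambda>i. PiE {..<s + t} (\<lambda>j. if j < s then {z j} else block n D z s (?idx i j)))"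
        define F where "F = (\<lambda>i. \<Union>y\<in>Y i. edge_image y E)"
        let ?\<mu> = "\<lambda>i. real (card (Y i)) * ?p ^ card E"
        have idx: "?idx i j < D" if "i < T" "s \<le> j" "j < s + t" for i j
        proof -
          have "?idx i j < (i + 1) * t" using that by simp
          also have "\<dots> \<le> T * t" using that(1) by (intro mult_right_mono) auto
          finally show ?thesis by (simp add: D_def)
        qed
        have idx_inj: "i = i' \<and> j = j'" if "?idx i j = ?idx i' j'" "s \<le> j" "j < s + t" "s \<le> j'" "j' < s + t" for i i' j j'
        proof -
          have "(a * t + b) div t = a" if "b < t" for a b using that by simp
          from this[of "j - s" i] this[of "j' - s" i']
          have "?idx i j div t = i" "?idx i' j' div t = i'" using that(2-5) by simp_all
          then have "i = i'" using that(1) by metis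
          then show ?thesis using that by auto
        qed
        have in_blk: "y j \<in> block n D z s (?idx i j)" if "y \<in> Y i" "s \<le> j" "j < s + t" for y i j
        proof -
          have "y j \<in> (if j < s then {z j} else block n D z s (?idx i j))"
            using that(1) unfolding Y_def by (rule PiE_mem) (use that in simp)
          then show ?thesis using that by simp
        qed
        have in_root: "y j = z j" if "y \<in> Y i" "j < s" for y i j
        proof -
          have "y j \<in> (if j < s then {z j} else block n D z s (?idx i j))"
            using that(1) unfolding Y_def by (rule PiE_mem) (use that in simp)
          then show ?thesis using that by simp
        qed
        have YE: "Y i \<subseteq> ext_maps {1..n} z s t" if i: "i < T" for i
        proof
          fix y assume y: "y \<in> Y i"
          have "y j \<in> {1..n}" if "j < s + t" for j
            using in_blk[OF y, of j] in_root[OF y, of j] idx[OF i, of j] block_subset[of "?idx i j" D n z s] z that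
            by (cases "j < s") auto
          moreover have "inj_on y {..<s + t}"
          proof (rule inj_onI)
            fix j j' assume j: "j \<in> {..<s + t}" "j' \<in> {..<s + t}" "y j = y j'"
            consider "j < s" "j' < s" | "j < s" "s \<le> j'" | "s \<le> j" "j' < s" | "s \<le> j" "s \<le> j'" by linarith
            then show "j = j'"
            proof cases
              case 1 then show ?thesis using j in_root[OF y] z(1) by (auto simp: inj_on_def)
            next
              case 2
              then have "y j' \<in> z ` {..<s}" using j(3) in_root[OF y, of j] by (metis imageI lessThan_iff)
              then show ?thesis using 2 j(2) in_blk[OF y, of j'] by (auto simp: block_def)
            next
              case 3
              then have "y j \<in> z ` {..<s}" using j(3) in_root[OF y, of j'] by (metis imageI lessThan_iff)
              then show ?thesis using 3 j(1) in_blk[OF y, of j] by (auto simp: block_def)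
            next
              case 4
              then have "?idx i j = ?idx i j'"
                using j in_blk[OF y, of j] in_blk[OF y, of j'] block_disjoint by auto
              then show ?thesis using idx_inj 4 j by blast
            qed
          qed
          moreover have "y \<in> extensional {..<s + t}" using y by (auto simp: Y_def PiE_def)
          ultimately show "y \<in> ext_maps {1..n} z s t"
            using in_root[OF y] by (auto simp: ext_maps_def PiE_def)
        qed
        have cardY: "(real n / (2 * real D)) ^ t \<le> real (card (Y i))" for i
        proof -
          have "card (Y i) = (\<Prod>j<s + t. card (if j < s then {z j} else block n D z s (?idx i j)))"
            by (simp add: Y_def card_PiE)
          also have "\<dots> = (\<Prod>j\<in>{..<s} \<union> {s..<s + t}. card (if j < s then {z j} else block n D z s (?idx i j)))"
            by (rule prod.cong) auto
          also have "\<dots> = (\<Prod>j\<in>{s..<s + t}. card (block n D z s (?idx i j)))"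
            by (subst prod.union_disjoint) auto
          finally have "real (card (Y i)) = (\<Prod>j\<in>{s..<s + t}. real (card (block n D z s (?idx i j))))"
            by simp
          also have "\<dots> \<ge> (\<Prod>j\<in>{s..<s + t}. real n / (2 * real D))"
            by (rule prod_mono) (use blk in auto)
          finally show ?thesis by simp
        qed
        have \<mu>: "c * real n powr ?w \<le> ?\<mu> i" for i
        proof -
          have "c * real n powr ?w = (real n / (2 * real D)) ^ t * ?p ^ card E"
          proof -
            have "real n powr ?w = real n ^ t * ?p ^ card E"
              using n1 by (simp add: powr_realpow[symmetric] powr_powr powr_add[symmetric])
            then show ?thesis by (simp add: c_def power_divide)
          qed
          also have "\<dots> \<le> ?\<mu> i" by (rule mult_right_mono[OF cardY]) simp
          finally show ?thesis .
        qed
        have "0 < c * real n powr ?w" using c n1 by simp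
        then have \<mu>0: "0 < ?\<mu> i" for i using \<mu>[of i] by linarith
        let ?bad = "\<lambda>i X. real (card {y \<in> Y i. edge_image y E \<subseteq> X}) < ?\<mu> i / 2"
        \<comment> \<open>Whether a family has too few copies depends only on the pairs it can use,
          as \<open>prob_gnp_indep\<close> requires.\<close>
        have bad_Int: "?bad i (edges G \<inter> F i) \<longleftrightarrow> ?bad i (edges G)" for i and G :: "nat graph"
        proof -
          have "{y \<in> Y i. edge_image y E \<subseteq> edges G \<inter> F i} = {y \<in> Y i. edge_image y E \<subseteq> edges G}"
            by (auto simp: F_def)
          then show ?thesis by simp
        qed
        have "measure_pmf.prob ?M {G. \<not> c / 2 * real (card (verts G)) powr ?w \<le> real (card (copies G z s t E)) \<and> verts G = {1..n}}
           \<le> measure_pmf.prob ?M {G. \<forall>i\<in>{..<T}. ?bad i (edges G \<inter> F i)}"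
        proof (rule measure_pmf.finite_measure_mono)
          show "{G. \<not> c / 2 * real (card (verts G)) powr ?w \<le> real (card (copies G z s t E)) \<and> verts G = {1..n}}
             \<subseteq> {G. \<forall>i\<in>{..<T}. ?bad i (edges G \<inter> F i)}"
          proof clarify
            fix G :: "nat graph" and i
            assume G: "\<not> c / 2 * real (card (verts G)) powr ?w \<le> real (card (copies G z s t E))" "verts G = {1..n}"
              and i: "i < T"
            have "card {y \<in> Y i. edge_image y E \<subseteq> edges G} \<le> card (copies G z s t E)"
              by (rule card_mono) (use G YE[OF i] in \<open>auto simp: copies_def finite_ext_maps\<close>)
            then have "?bad i (edges G)" using G \<mu>[of i] by auto
            then show "?bad i (edges G \<inter> F i)" by (simp only: bad_Int)
          qed
        qed simp
        also have "\<dots> = (\<Prod>i\<in>{..<T}. measure_pmf.prob ?M {G. ?bad i (edges G \<inter> F i)})"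
        proof (rule prob_gnp_indep)
          show "F i \<subseteq> vertex_pairs {1..n}" if "i \<in> {..<T}" for i
            using YE[of i] that edge_image_pairs[OF _ E] by (fastforce simp: F_def)
          show "disjoint_family_on F {..<T}"
          proof (unfold disjoint_family_on_def, intro ballI impI)
            fix i i' assume "i \<in> {..<T}" "i' \<in> {..<T}" "i \<noteq> i'"
            \<comment> \<open>An edge of \<open>E\<close> has a new endpoint; the block that
              contains its image reveals the family.\<close>
            have False if d: "d \<in> F i" "d \<in> F i'" for d
            proof -
              obtain y e where y: "y \<in> Y i" "e \<in> E" "d = y ` e" using d by (auto simp: F_def edge_image_def)
              obtain y' e' where y': "y' \<in> Y i'" "e' \<in> E" "d = y' ` e'" using d by (auto simp: F_def edge_image_def)
              obtain j where j: "j \<in> e" "s \<le> j" "j < s + t" using y(2) E by (fastforce simp: slots_def)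
              have b: "y j \<in> block n D z s (?idx i j)" by (rule in_blk) (use y j in auto)
              have "y j \<in> y' ` e'" using y y' j by auto
              then obtain j' where j': "j' \<in> e'" "y j = y' j'" by auto
              have j't: "j' < s + t" using j'(1) y'(2) E by (auto simp: slots_def)
              show False
              proof (cases "j' < s")
                case True
                then have "y j \<in> z ` {..<s}" using j' in_root[OF y'(1), of j'] by (metis imageI lessThan_iff)
                then show False using b by (auto simp: block_def)
              next
                case False
                then have "y' j' \<in> block n D z s (?idx i' j')" by (intro in_blk) (use y' j't in auto)
                then have "?idx i j = ?idx i' j'" using b j'(2) block_disjoint by auto
                then have "i = i'" using idx_inj[of i j i' j'] j j't False by simp
                then show False using \<open>i \<noteq> i'\<close> by simp
              qed
            qed
            then show "F i \<inter> F i' = {}" by auto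
          qed
        qed (use T1 in \<open>auto simp: lessThan_empty_iff\<close>)
        also have "\<dots> \<le> (\<Prod>i\<in>{..<T}. 4 * ?C / c * real n powr (-\<eta>))"
        proof (rule prod_mono, intro conjI)
          fix i assume i: "i \<in> {..<T}"
          have "measure_pmf.prob ?M {G. ?bad i (edges G \<inter> F i)} = measure_pmf.prob ?M {G. ?bad i (edges G)}"
            by (simp only: bad_Int)
          also have "\<dots> \<le> 4 * (?C * real n powr (?w - \<eta>)) / ?\<mu> i"
            by (rule prob_copies_small[OF n1 al E YE \<eta> refl \<mu>0]) (use i in auto)
          also have "\<dots> \<le> 4 * (?C * real n powr (?w - \<eta>)) / (c * real n powr ?w)"
            by (rule divide_left_mono[OF \<mu>]) (use \<mu>0[of i] c n1 in auto)
          also have "\<dots> = 4 * ?C / c * real n powr (-\<eta>)"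
          proof -
            have "real n powr (?w - \<eta>) = real n powr (-\<eta>) * real n powr ?w"
              by (simp add: powr_add[symmetric])
            then show ?thesis using n1 c by simp
          qed
          finally show "measure_pmf.prob ?M {G. ?bad i (edges G \<inter> F i)} \<le> 4 * ?C / c * real n powr (-\<eta>)" .
        qed simp
        also have "\<dots> = ?b n" by simp
        finally show "measure_pmf.prob ?M {G. \<not> c / 2 * real (card (verts G)) powr ?w \<le> real (card (copies G z s t E)) \<and> verts G = {1..n}}
          \<le> ?b n" .
      qed
    qed
  qed
  then show ?thesis using c by (intro exI[of _ "c / 2"]) auto
qed

section \<open>Strong sets and generic extensions\<close>

definition wf_graph :: "'v graph \<Rightarrow> bool" where
  "wf_graph G \<longleftrightarrow> finite (verts G) \<and> edges G \<subseteq> vertex_pairs (verts G)"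

definition rel_edges :: "'v graph \<Rightarrow> 'v set \<Rightarrow> 'v set \<Rightarrow> 'v set set" where
  "rel_edges G A C = {e \<in> edges G. e \<subseteq> C \<and> \<not> e \<subseteq> A}"

text \<open>The predimension of \<open>C\<close> over \<open>A\<close> in model theory: the exponent
  of n in the expected number of such extensions over fixed roots.\<close>

definition rel_weight :: "real \<Rightarrow> 'v graph \<Rightarrow> 'v set \<Rightarrow> 'v set \<Rightarrow> real" where
  "rel_weight \<alpha> G A C = real (card (C - A)) - \<alpha> * real (card (rel_edges G A C))"

text \<open>Self-sufficiency, truncated at extensions by at most \<open>k\<close> vertices.\<close>

definition strong :: "real \<Rightarrow> nat \<Rightarrow> 'v graph \<Rightarrow> 'v set \<Rightarrow> bool" where
  "strong \<alpha> k G A \<longleftrightarrow> A \<subseteq> verts G \<and>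
     (\<forall>C. A \<subseteq> C \<longrightarrow> C \<subseteq> verts G \<longrightarrow> card (C - A) \<le> k \<longrightarrow> 0 \<le> rel_weight \<alpha> G A C)"

text \<open>The template that \<open>y\<close> realises in \<open>G\<close>; a copy of
  \<open>E\<close> has no extra edges exactly if this set equals \<open>E\<close>.\<close>

definition pull_edges :: "'v graph \<Rightarrow> (nat \<Rightarrow> 'v) \<Rightarrow> nat \<Rightarrow> nat \<Rightarrow> nat set set" where
  "pull_edges G y s t = {e \<in> slots s t. y ` e \<in> edges G}"

section \<open>Additivity of weights, and passage between templates and vertex sets of a
  graph\<close>

lemma strong_mono: "strong \<alpha> k G A \<Longrightarrow> k' \<le> k \<Longrightarrow> strong \<alpha> k' G A"
  by (auto simp: strong_def)

lemma wf_finite_edges: "wf_graph G \<Longrightarrow> finite (edges G)"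
  unfolding wf_graph_def using finite_vertex_pairs finite_subset by blast

lemma rel_weight_add:
  assumes "wf_graph G" "A \<subseteq> B" "B \<subseteq> C" "C \<subseteq> verts G"
  shows "rel_weight \<alpha> G A C = rel_weight \<alpha> G A B + rel_weight \<alpha> G B C"
proof -
  have finC: "finite C" using assms by (auto simp: wf_graph_def intro: finite_subset)
  then have finB: "finite B" using assms(3) finite_subset by blast
  have "C - A = (B - A) \<union> (C - B)" using assms by auto
  then have "card (C - A) = card (B - A) + card (C - B)"
    using finB finC by (simp only:) (rule card_Un_disjoint, auto)
  moreover have "rel_edges G A C = rel_edges G A B \<union> rel_edges G B C"
    using assms by (auto simp: rel_edges_def)
  then have "card (rel_edges G A C) = card (rel_edges G A B) + card (rel_edges G B C)"
    using wf_finite_edges[OF assms(1)] by (simp only:) (rule card_Un_disjoint, auto simp: rel_edges_def)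
  ultimately show ?thesis by (simp add: rel_weight_def algebra_simps)
qed

text \<open>The only use of irrationality: a zero would give \<alpha> = v / e.\<close>

lemma irrational_combination_neq_0:
  assumes "\<alpha> \<notin> \<rat>" "v \<noteq> 0"
  shows "real v - \<alpha> * real e \<noteq> 0"
proof
  assume *: "real v - \<alpha> * real e = 0"
  then have "e \<noteq> 0" using assms(2) by (cases e) auto
  then have "\<alpha> = real v / real e" using * by (simp add: field_simps)
  then show False using assms(1) by simp
qed

lemma card_pull_edges:
  assumes G: "wf_graph G" and inj: "inj_on y {..<s + t}" and S: "S \<subseteq> {s..<s + t}"
  shows "card {e \<in> pull_edges G y s t. e \<subseteq> {..<s} \<union> S} = card (rel_edges G (y ` {..<s}) (y ` ({..<s} \<union> S)))"
proof (rule bij_betw_same_card[where f = "\<lambda>e. y ` e"])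
  have Q: "{..<s} \<union> S \<subseteq> {..<s + t}" using S by auto
  show "bij_betw ((`) y) {e \<in> pull_edges G y s t. e \<subseteq> {..<s} \<union> S} (rel_edges G (y ` {..<s}) (y ` ({..<s} \<union> S)))"
    unfolding bij_betw_def
  proof (intro conjI equalityI subsetI)
    show "inj_on ((`) y) {e \<in> pull_edges G y s t. e \<subseteq> {..<s} \<union> S}"
      using inj_on_image_Pow[OF inj] by (rule inj_on_subset) (auto simp: pull_edges_def slots_def)
  next
    fix d assume "d \<in> (`) y ` {e \<in> pull_edges G y s t. e \<subseteq> {..<s} \<union> S}"
    then obtain e where e: "e \<in> slots s t" "e \<subseteq> {..<s} \<union> S" "d = y ` e" "d \<in> edges G"
      by (auto simp: pull_edges_def)
    have "\<not> y ` e \<subseteq> y ` {..<s}"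
      using e(1) inj_on_image_subset_iff[OF inj, of e "{..<s}"] by (auto simp: slots_def)
    then show "d \<in> rel_edges G (y ` {..<s}) (y ` ({..<s} \<union> S))"
      using e by (auto simp: rel_edges_def)
  next
    fix d assume d: "d \<in> rel_edges G (y ` {..<s}) (y ` ({..<s} \<union> S))"
    define e where "e = {i \<in> {..<s} \<union> S. y i \<in> d}"
    have de: "d = y ` e" using d by (auto simp: rel_edges_def e_def)
    have "card d = 2" using d G by (auto simp: rel_edges_def wf_graph_def card_vertex_pair)
    moreover have "inj_on y e" using inj by (rule inj_on_subset) (use Q in \<open>auto simp: e_def\<close>)
    ultimately have "card e = 2" by (simp add: de card_image)
    moreover have "\<not> e \<subseteq> {..<s}" using d by (auto simp: de rel_edges_def)
    ultimately have "e \<in> slots s t" using Q by (auto simp: slots_def e_def)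
    moreover have "y ` e \<in> edges G" using d unfolding de[symmetric] by (simp add: rel_edges_def)
    ultimately have "e \<in> pull_edges G y s t" by (simp add: pull_edges_def)
    moreover have "e \<subseteq> {..<s} \<union> S" unfolding e_def by blast
    ultimately show "d \<in> (`) y ` {e \<in> pull_edges G y s t. e \<subseteq> {..<s} \<union> S}"
      by (intro image_eqI[where x = e]) (simp_all only: de mem_Collect_eq)
  qed
qed

lemma tweight_pull_edges:
  assumes G: "wf_graph G" and inj: "inj_on y {..<s + t}" and S: "S \<subseteq> {s..<s + t}"
  shows "tweight \<alpha> s (pull_edges G y s t) S = rel_weight \<alpha> G (y ` {..<s}) (y ` ({..<s} \<union> S))"
proof -
  have "({..<s} \<union> S) - {..<s} = S" using S by auto
  moreover have "{..<s} \<union> S \<subseteq> {..<s + t}" using S by auto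
  then have "y ` (({..<s} \<union> S) - {..<s}) = y ` ({..<s} \<union> S) - y ` {..<s}"
    by (intro inj_on_image_set_diff[OF inj]) auto
  ultimately have "y ` ({..<s} \<union> S) - y ` {..<s} = y ` S" by simp
  moreover have "inj_on y S" using inj by (rule inj_on_subset) (use S in auto)
  ultimately have "card (y ` ({..<s} \<union> S) - y ` {..<s}) = card S"
    by (simp only: card_image)
  then show ?thesis
    by (simp add: tweight_def rel_weight_def card_pull_edges[OF assms])
qed

lemma pull_edges_slots: "pull_edges G y s t \<subseteq> slots s t"
  by (auto simp: pull_edges_def)

lemma pull_edges_total:
  assumes G: "wf_graph G" and inj: "inj_on y {..<s + t}"
  shows "real t - \<alpha> * real (card (pull_edges G y s t)) = rel_weight \<alpha> G (y ` {..<s}) (y ` {..<s + t})"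
proof -
  have "{e \<in> pull_edges G y s t. e \<subseteq> {..<s} \<union> {s..<s + t}} = pull_edges G y s t"
    using ivl_disj_un_one(2)[of s "s + t"] by (auto simp: pull_edges_def slots_def)
  then show ?thesis
    using tweight_pull_edges[OF assms, of "{s..<s + t}" \<alpha>] ivl_disj_un_one(2)[of s "s + t"]
    by (simp add: tweight_def)
qed

text \<open>Strongness bounds the weight of \<open>S\<close> below by 0, and irrationality excludes
  0. Thus extensions of strong sets give templates to which the counting applies.\<close>

lemma safe_pull_edges:
  assumes G: "wf_graph G" and irr: "\<alpha> \<notin> \<rat>" and z: "strong \<alpha> k G (z ` {..<s})" and k: "t \<le> k"
    and y: "y \<in> ext_maps (verts G) z s t"
  shows "safe \<alpha> s t (pull_edges G y s t)"
  unfolding safe_def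
proof (intro conjI allI impI pull_edges_slots)
  fix S assume S: "S \<subseteq> {s..<s + t}" "S \<noteq> {}"
  let ?C = "y ` ({..<s} \<union> S)"
  have inj: "inj_on y {..<s + t}" and yV: "y ` {..<s + t} \<subseteq> verts G" and ys: "y ` {..<s} = z ` {..<s}"
    using y by (auto simp: ext_maps_def)
  have w: "tweight \<alpha> s (pull_edges G y s t) S = rel_weight \<alpha> G (y ` {..<s}) ?C"
    by (rule tweight_pull_edges[OF G inj S(1)])
  have CA: "?C - y ` {..<s} \<subseteq> y ` S" by auto
  have cS: "card S \<le> t" "finite S" using card_mono[OF _ S(1)] S(1) finite_subset by auto
  have "card (?C - y ` {..<s}) \<le> card (y ` S)" using CA cS(2) by (intro card_mono) auto
  also have "\<dots> \<le> card S" by (rule card_image_le[OF cS(2)])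
  finally have "card (?C - y ` {..<s}) \<le> k" using cS(1) k by linarith
  moreover have "{..<s} \<union> S \<subseteq> {..<s + t}" using S(1) by auto
  then have "?C \<subseteq> verts G" using yV by blast
  moreover have "y ` {..<s} \<subseteq> ?C" by blast
  ultimately have "0 \<le> rel_weight \<alpha> G (y ` {..<s}) ?C"
    using z unfolding strong_def ys[symmetric] by blast
  moreover have "tweight \<alpha> s (pull_edges G y s t) S \<noteq> 0"
    unfolding tweight_def using S(2) cS by (intro irrational_combination_neq_0[OF irr]) auto
  ultimately show "0 < tweight \<alpha> s (pull_edges G y s t) S" using w by linarith
qed

text \<open>Turns a larger vertex set into an extension map: old elements keep their indices, new
  ones come after them.\<close>

lemma extend_enumeration:
  assumes inj: "inj_on y {..<r}" and C: "finite C" "y ` {..<r} \<subseteq> C" "card (C - y ` {..<r}) = t"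
  obtains y' where "inj_on y' {..<r + t}" "y' ` {..<r + t} = C" "\<And>i. i < r \<Longrightarrow> y' i = y i"
    "y' \<in> extensional {..<r + t}"
proof -
  have "card {r..<r + t} = card (C - y ` {..<r})" using C by simp
  then obtain h where h: "bij_betw h {r..<r + t} (C - y ` {..<r})"
    using finite_same_card_bij[of "{r..<r + t}" "C - y ` {..<r}"] C by auto
  define y' where "y' = (\<lambda>i. if i < r then y i else if i < r + t then h i else undefined)"
  have un: "{..<r + t} = {..<r} \<union> {r..<r + t}" by auto
  have "bij_betw y' {..<r} (y ` {..<r})"
    using inj by (auto simp: bij_betw_def y'_def inj_on_def)
  moreover have "bij_betw y' {r..<r + t} (C - y ` {..<r})"
    using h by (subst bij_betw_cong[of _ _ h]) (auto simp: y'_def)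
  ultimately have "bij_betw y' ({..<r} \<union> {r..<r + t}) (y ` {..<r} \<union> (C - y ` {..<r}))"
    by (rule bij_betw_combine) auto
  moreover have "y ` {..<r} \<union> (C - y ` {..<r}) = C" using C by auto
  ultimately have "bij_betw y' {..<r + t} C" using un by simp
  then show ?thesis
    by (intro that[of y']) (auto simp: bij_betw_def y'_def extensional_def)
qed

definition generic :: "real \<Rightarrow> nat \<Rightarrow> 'v graph \<Rightarrow> nat \<Rightarrow> nat \<Rightarrow> nat set set \<Rightarrow> (nat \<Rightarrow> 'v) \<Rightarrow> bool" where
  "generic \<alpha> k G s t E y \<longleftrightarrow> strong \<alpha> k G (y ` {..<s + t}) \<and> pull_edges G y s t = E"

text \<open>Level t + k allows for an extension by t vertices followed by one by k. The bound
  \<open>1 / \<zeta>\<close> will make the s roots negligible among the copies.\<close>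

definition gen_ext :: "real \<Rightarrow> nat \<Rightarrow> nat \<Rightarrow> nat set set \<Rightarrow> nat \<Rightarrow> real \<Rightarrow> 'v graph \<Rightarrow> bool" where
  "gen_ext \<alpha> s t E k \<zeta> G \<longleftrightarrow> (\<forall>z. inj_on z {..<s} \<longrightarrow> strong \<alpha> (t + k) G (z ` {..<s}) \<longrightarrow>
     real (card {y \<in> copies G z s t E. \<not> generic \<alpha> k G s t E y}) \<le> \<zeta> * real (card (copies G z s t E)) \<and>
     1 / \<zeta> \<le> real (card (copies G z s t E)))"

text \<open>
  A nongeneric copy is part of a copy of a larger template of smaller weight, and there are
  far fewer of these.
\<close>

lemma nongeneric_extends:
  assumes G: "wf_graph G" and al: "0 < \<alpha>" and irr: "\<alpha> \<notin> \<rat>"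
    and z: "inj_on z {..<s}" "strong \<alpha> (t + k) G (z ` {..<s})" and E: "E \<subseteq> slots s t"
    and y: "y \<in> copies G z s t E" "\<not> generic \<alpha> k G s t E y"
  shows "\<exists>t' E' y'. t' \<le> t + k \<and> safe \<alpha> s t' E' \<and> real t' - \<alpha> * real (card E') < real t - \<alpha> * real (card E)
     \<and> y' \<in> copies G z s t' E' \<and> y = restrict y' {..<s + t}"
proof -
  let ?A = "z ` {..<s}" and ?B = "y ` {..<s + t}" and ?w = "real t - \<alpha> * real (card E)"
  have ym: "y \<in> ext_maps (verts G) z s t" using y by (auto simp: copies_def)
  then have inj: "inj_on y {..<s + t}" and BV: "?B \<subseteq> verts G" and ys: "y ` {..<s} = ?A"
    by (auto simp: ext_maps_def)
  have AB: "?A \<subseteq> ?B" unfolding ys[symmetric] by auto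
  have finV: "finite (verts G)" using G by (simp add: wf_graph_def)
  have sub: "E \<subseteq> pull_edges G y s t" using y E by (auto simp: copies_def pull_edges_def edge_image_def)
  have finp: "finite (pull_edges G y s t)" by (rule finite_slots_subset[OF pull_edges_slots])
  have wB: "rel_weight \<alpha> G ?A ?B = real t - \<alpha> * real (card (pull_edges G y s t))"
    using pull_edges_total[OF G inj] ys by simp
  \<comment> \<open>The obstruction \<open>C\<close> is \<open>?B\<close> itself if the copy has
    extra edges, and otherwise a superset of negative weight over \<open>?B\<close>.\<close>
  have "\<exists>C. ?B \<subseteq> C \<and> C \<subseteq> verts G \<and> card (C - ?B) \<le> k \<and> rel_weight \<alpha> G ?A C < ?w"
  proof (cases "pull_edges G y s t = E")
    case False
    then have "card E < card (pull_edges G y s t)" using sub by (intro psubset_card_mono finp) auto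
    then have "rel_weight \<alpha> G ?A ?B < ?w" unfolding wB using al by simp
    then show ?thesis using BV by (intro exI[of _ ?B]) auto
  next
    case True
    then have "\<not> strong \<alpha> k G ?B" using y(2) by (simp add: generic_def)
    then obtain C where C: "?B \<subseteq> C" "C \<subseteq> verts G" "card (C - ?B) \<le> k" "rel_weight \<alpha> G ?B C < 0"
      using BV by (auto simp: strong_def not_le)
    moreover have "rel_weight \<alpha> G ?A C = rel_weight \<alpha> G ?A ?B + rel_weight \<alpha> G ?B C"
      by (rule rel_weight_add[OF G AB C(1,2)])
    ultimately show ?thesis using wB True by (intro exI[of _ C]) auto
  qed
  then obtain C where C: "?B \<subseteq> C" "C \<subseteq> verts G" "card (C - ?B) \<le> k" "rel_weight \<alpha> G ?A C < ?w" by blast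
  have finC: "finite C" using C(2) finV finite_subset by blast
  define t2 where "t2 = card (C - ?B)"
  obtain y' where y': "inj_on y' {..<s + t + t2}" "y' ` {..<s + t + t2} = C" "\<And>i. i < s + t \<Longrightarrow> y' i = y i"
    "y' \<in> extensional {..<s + t + t2}"
    using extend_enumeration[OF inj finC C(1) t2_def[symmetric]] by metis
  have y'm: "y' \<in> ext_maps (verts G) z s (t + t2)"
    using y' C(2) ym by (fastforce simp: ext_maps_def PiE_def add.assoc)
  let ?E' = "pull_edges G y' s (t + t2)"
  have le: "t + t2 \<le> t + k" using C(3) by (simp add: t2_def)
  have "y' ` {..<s} = ?A" using y'm by (auto simp: ext_maps_def)
  then have "real (t + t2) - \<alpha> * real (card ?E') = rel_weight \<alpha> G ?A C"
    using pull_edges_total[OF G, of y' s "t + t2" \<alpha>] y' by (simp add: add.assoc)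
  moreover have "safe \<alpha> s (t + t2) ?E'"
    by (rule safe_pull_edges[OF G irr z(2) le y'm])
  moreover have "y' \<in> copies G z s (t + t2) ?E'"
    using y'm by (auto simp: copies_def edge_image_def pull_edges_def)
  \<comment> \<open>Restriction recovers the copy, so nongeneric copies are at most as numerous as
    the copies of all these templates together.\<close>
  moreover have "y = restrict y' {..<s + t}"
    using y'(3) ym by (auto simp: ext_maps_def PiE_def extensional_def restrict_def)
  ultimately show ?thesis using C(4) le by metis
qed

lemma whp_wf_graph: "whp \<alpha> (\<lambda>G. wf_graph G \<and> m \<le> card (verts G))"
  by (rule whp_support) (auto simp: wf_graph_def eventually_sequentially intro: exI[of _ m])

lemma whp_gen_ext:
  assumes al: "0 < \<alpha>" and irr: "\<alpha> \<notin> \<rat>" and safe: "safe \<alpha> s t E" and t: "1 \<le> t" and \<zeta>: "0 < \<zeta>"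
  shows "whp \<alpha> (gen_ext \<alpha> s t E k \<zeta>)"
proof -
  let ?w = "real t - \<alpha> * real (card E)"
  have E: "E \<subseteq> slots s t" using safe by (simp add: safe_def)
  have w: "0 < ?w"
  proof -
    have "{e \<in> E. e \<subseteq> {..<s} \<union> {s..<s + t}} = E"
      using E ivl_disj_un_one(2)[of s "s + t"] by (auto simp: slots_def)
    moreover have "0 < tweight \<alpha> s E {s..<s + t}" using safe t by (auto simp: safe_def)
    ultimately show ?thesis by (simp add: tweight_def)
  qed
  obtain c where c: "0 < c" and ge: "whp \<alpha> (\<lambda>G. \<forall>z. inj_on z {..<s} \<longrightarrow> z ` {..<s} \<subseteq> verts G \<longrightarrow>
     c * real (card (verts G)) powr ?w \<le> real (card (copies G z s t E)))"
    using whp_copies_ge[OF al safe t] by blast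
  \<comment> \<open>All templates that a nongeneric copy can lead to; finitely many, since they have
    at most t + k new vertices.\<close>
  define I where "I = {(t', E'). t' \<le> t + k \<and> safe \<alpha> s t' E' \<and> real t' - \<alpha> * real (card E') < ?w}"
  have finI: "finite I"
    by (rule finite_subset[of _ "Sigma {..t + k} (\<lambda>t'. Pow (slots s t'))"])
       (auto simp: I_def safe_def finite_slots)
  \<comment> \<open>Makes card I * \<xi> at most \<zeta> * c; the summand 1 covers an empty
    \<open>I\<close>.\<close>
  define \<xi> where "\<xi> = \<zeta> * c / (1 + real (card I))"
  have \<xi>: "0 < \<xi>" using c \<zeta> by (auto simp: \<xi>_def)
  have le: "whp \<alpha> (\<lambda>G. \<forall>x\<in>I. \<forall>z. inj_on z {..<s} \<longrightarrow> z ` {..<s} \<subseteq> verts G \<longrightarrow>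
     real (card (copies G z s (fst x) (snd x))) \<le> \<xi> * real (card (verts G)) powr ?w)"
    by (rule whp_ball_finite[OF finI]) (rule whp_copies_le[OF al _ _ \<xi>], auto simp: I_def)
  \<comment> \<open>As soon as n powr ?w reaches \<open>X\<close>, c * n powr ?w is at least 1 /
    \<zeta>. This happens for large n because ?w > 0, which rests on t \<ge> 1.\<close>
  define X where "X = 1 / (\<zeta> * c)"
  have X: "0 < X" using c \<zeta> by (simp add: X_def)
  obtain m :: nat where m0: "X powr (1 / ?w) < real m" using reals_Archimedean2 by blast
  have m: "1 / \<zeta> \<le> c * real n powr ?w" if "m \<le> n" for n
  proof -
    have "X = (X powr (1 / ?w)) powr ?w" using w X by (simp add: powr_powr)
    also have "\<dots> \<le> real n powr ?w" using w m0 that by (intro powr_mono2) auto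
    finally show ?thesis using c \<zeta> by (simp add: X_def field_simps)
  qed
  show ?thesis
  proof (rule whp_mono[OF whp_conj[OF whp_wf_graph[of _ m] whp_conj[OF ge le]]])
    fix G :: "nat graph"
    assume G: "(wf_graph G \<and> m \<le> card (verts G)) \<and>
      (\<forall>z. inj_on z {..<s} \<longrightarrow> z ` {..<s} \<subseteq> verts G \<longrightarrow>
        c * real (card (verts G)) powr ?w \<le> real (card (copies G z s t E))) \<and>
      (\<forall>x\<in>I. \<forall>z. inj_on z {..<s} \<longrightarrow> z ` {..<s} \<subseteq> verts G \<longrightarrow>
         real (card (copies G z s (fst x) (snd x))) \<le> \<xi> * real (card (verts G)) powr ?w)"
    then have wf: "wf_graph G" and fin: "finite (verts G)" by (auto simp: wf_graph_def)
    let ?n = "real (card (verts G)) powr ?w"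
    show "gen_ext \<alpha> s t E k \<zeta> G"
      unfolding gen_ext_def
    proof (intro allI impI conjI)
      fix z assume z: "inj_on z {..<s}" "strong \<alpha> (t + k) G (z ` {..<s})"
      then have zV: "z ` {..<s} \<subseteq> verts G" by (simp add: strong_def)
      have ge': "c * ?n \<le> real (card (copies G z s t E))" using G z(1) zV by auto
      then show "1 / \<zeta> \<le> real (card (copies G z s t E))" using m[of "card (verts G)"] G by linarith
      let ?cp = "\<lambda>x. copies G z s (fst x) (snd x)"
      have "{y \<in> copies G z s t E. \<not> generic \<alpha> k G s t E y} \<subseteq> (\<Union>x\<in>I. (\<lambda>y'. restrict y' {..<s + t}) ` ?cp x)"
        using nongeneric_extends[OF wf al irr z E] by (fastforce simp: I_def)
      then have "card {y \<in> copies G z s t E. \<not> generic \<alpha> k G s t E y} \<le> card (\<Union>x\<in>I. (\<lambda>y'. restrict y' {..<s + t}) ` ?cp x)"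
        by (rule card_mono[rotated]) (auto simp: finI finite_copies[OF fin])
      also have "\<dots> \<le> (\<Sum>x\<in>I. card ((\<lambda>y'. restrict y' {..<s + t}) ` ?cp x))"
        by (rule card_UN_le[OF finI])
      also have "\<dots> \<le> (\<Sum>x\<in>I. card (?cp x))"
        by (intro sum_mono card_image_le finite_copies[OF fin])
      finally have "real (card {y \<in> copies G z s t E. \<not> generic \<alpha> k G s t E y}) \<le> (\<Sum>x\<in>I. real (card (?cp x)))"
        unfolding of_nat_sum[symmetric] by (rule of_nat_mono)
      also have "\<dots> \<le> (\<Sum>x\<in>I. \<xi> * ?n)"
        by (rule sum_mono) (use G z(1) zV in auto)
      also have "\<dots> = real (card I) / (1 + real (card I)) * (\<zeta> * (c * ?n))" by (simp add: \<xi>_def)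
      also have "\<dots> \<le> 1 * (\<zeta> * (c * ?n))"
        by (rule mult_right_mono) (use c \<zeta> in \<open>auto simp: field_simps\<close>)
      also have "\<dots> \<le> \<zeta> * real (card (copies G z s t E))" using ge' \<zeta> by simp
      finally show "real (card {y \<in> copies G z s t E. \<not> generic \<alpha> k G s t E y}) \<le> \<zeta> * real (card (copies G z s t E))" .
    qed
  qed
qed

section \<open>Strongness of the empty set, by first moments\<close>

lemma whp_no_copies:
  assumes al: "0 < \<alpha>" and E: "E \<subseteq> slots 0 t" and w: "real t - \<alpha> * real (card E) < 0"
  shows "whp \<alpha> (\<lambda>G. copies G z 0 t E = {})"
proof (rule whpI_bound)
  let ?w = "real t - \<alpha> * real (card E)"
  show "(\<lambda>n. 1 * real n powr ?w) \<longlonglongrightarrow> 0" by (rule tendsto_powr_neg_0[OF w])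
  show "\<forall>\<^sub>F n in sequentially. measure_pmf.prob (gnp n (real n powr - \<alpha>)) {G. copies G z 0 t E \<noteq> {}} \<le> 1 * real n powr ?w"
    using eventually_ge_at_top[of 1]
  proof eventually_elim
    case (elim n)
    let ?p = "real n powr (-\<alpha>)" and ?Y = "ext_maps {1..n} z 0 t"
    let ?M = "gnp n ?p"
    have p: "0 \<le> ?p" "?p \<le> 1" using elim al by (auto simp: powr_minus ge_one_powr_ge_zero inverse_le_1_iff)
    have "measure_pmf.prob ?M {G. copies G z 0 t E \<noteq> {}} = measure_pmf.prob ?M ({G. copies G z 0 t E \<noteq> {}} \<inter> set_pmf ?M)"
      by (simp add: measure_Int_set_pmf)
    also have "\<dots> \<le> measure_pmf.prob ?M (\<Union>y\<in>?Y. {G. edge_image y E \<subseteq> edges G})"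
    proof (rule measure_pmf.finite_measure_mono)
      show "{G. copies G z 0 t E \<noteq> {}} \<inter> set_pmf ?M \<subseteq> (\<Union>y\<in>?Y. {G. edge_image y E \<subseteq> edges G})"
        using gnp_support(1)[of _ n ?p] by (auto simp: copies_def)
    qed simp
    also have "\<dots> \<le> (\<Sum>y\<in>?Y. measure_pmf.prob ?M {G. edge_image y E \<subseteq> edges G})"
      by (rule measure_UNION_le) (auto simp: finite_ext_maps)
    also have "\<dots> = (\<Sum>y\<in>?Y. ?p ^ card E)"
    proof (rule sum.cong[OF refl])
      fix y assume y: "y \<in> ?Y"
      then have "card (edge_image y E) = card E" by (intro card_edge_image[OF _ E]) (auto simp: ext_maps_def)
      then show "measure_pmf.prob ?M {G. edge_image y E \<subseteq> edges G} = ?p ^ card E"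
        using prob_gnp_superset[OF p edge_image_pairs[OF y E]] by simp
    qed
    also have "\<dots> = real (card ?Y) * ?p ^ card E" by simp
    also have "\<dots> \<le> real n ^ t * ?p ^ card E"
    proof (rule mult_right_mono)
      have "card ?Y \<le> card ({..<0 + t} \<rightarrow>\<^sub>E {1..n})"
        by (rule card_mono) (auto simp: ext_maps_def finite_PiE)
      then have "card ?Y \<le> n ^ t" by (simp add: card_PiE)
      then show "real (card ?Y) \<le> real n ^ t" by (metis of_nat_mono of_nat_power)
    qed simp
    also have "\<dots> = 1 * real n powr ?w"
      using elim by (simp add: powr_realpow[symmetric] powr_powr powr_add[symmetric])
    finally show ?case .
  qed
qed

text \<open>A set of at most \<open>k\<close> vertices and negative weight is a copy of one of
  finitely many rootless templates of negative weight. Without roots no union bound is needed, and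
  \<open>?z\<close> is a dummy.\<close>

lemma whp_strong_empty:
  assumes al: "0 < \<alpha>"
  shows "whp \<alpha> (\<lambda>G. strong \<alpha> k G {})"
proof -
  let ?z = "\<lambda>_ :: nat. 0 :: nat"
  define I where "I = {(t, E). t \<le> k \<and> E \<subseteq> slots 0 t \<and> real t - \<alpha> * real (card E) < 0}"
  have finI: "finite I"
    by (rule finite_subset[of _ "Sigma {..k} (\<lambda>t. Pow (slots 0 t))"]) (auto simp: I_def finite_slots)
  have "whp \<alpha> (\<lambda>G. \<forall>x\<in>I. copies G ?z 0 (fst x) (snd x) = {})"
    by (rule whp_ball_finite[OF finI]) (rule whp_no_copies[OF al], auto simp: I_def)
  from whp_conj[OF whp_wf_graph[of _ 0] this] show ?thesis
  proof (rule whp_mono)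
    fix G :: "nat graph"
    assume *: "(wf_graph G \<and> 0 \<le> card (verts G)) \<and> (\<forall>x\<in>I. copies G ?z 0 (fst x) (snd x) = {})"
    then have G: "wf_graph G" by simp
    show "strong \<alpha> k G {}"
      unfolding strong_def
    proof (intro conjI allI impI)
      fix C assume C: "{} \<subseteq> C" "C \<subseteq> verts G" "card (C - {}) \<le> k"
      have finC: "finite C" using C G finite_subset by (auto simp: wf_graph_def)
      obtain y where y: "inj_on y {..<0 + card C}" "y ` {..<0 + card C} = C" "y \<in> extensional {..<0 + card C}"
        by (rule extend_enumeration[of ?z 0 C "card C"]) (use finC in auto)
      let ?E = "pull_edges G y 0 (card C)"
      have "y \<in> copies G ?z 0 (card C) ?E"
        using y C by (auto simp: copies_def ext_maps_def PiE_def edge_image_def pull_edges_def)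
      then have "(card C, ?E) \<notin> I" using * by force
      then have "0 \<le> real (card C) - \<alpha> * real (card ?E)"
        using C pull_edges_slots[of G y 0 "card C"] by (auto simp: I_def)
      then show "0 \<le> rel_weight \<alpha> G {} C"
        using pull_edges_total[OF G y(1)] y(2) by simp
    qed simp
  qed
qed

text \<open>For fixed v the weight decreases in e, so the negative value closest to 0 belongs to the
  least e above v / \<alpha>; only finitely many v occur.\<close>

lemma negative_weight_gap:
  assumes "0 < \<alpha>"
  shows "\<exists>\<eta>>0. \<forall>v\<le>k. \<forall>e. real v - \<alpha> * real e < 0 \<longrightarrow> real v - \<alpha> * real e \<le> -\<eta>"
proof -
  define g where "g = (\<lambda>v. \<alpha> * real (nat \<lfloor>real v / \<alpha>\<rfloor> + 1) - real v)"
  have floor: "real (nat \<lfloor>real v / \<alpha>\<rfloor>) = of_int \<lfloor>real v / \<alpha>\<rfloor>" for v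
    using assms by simp
  have g: "0 < g v" for v
  proof -
    have "real v / \<alpha> < real (nat \<lfloor>real v / \<alpha>\<rfloor> + 1)" unfolding of_nat_add floor by simp
    then show ?thesis using assms by (simp add: g_def pos_divide_less_eq mult.commute)
  qed
  show ?thesis
  proof (intro exI[of _ "Min (g ` {..k})"] conjI allI impI)
    show "0 < Min (g ` {..k})" using g by (subst Min_gr_iff) auto
    fix v e assume v: "v \<le> k" and neg: "real v - \<alpha> * real e < 0"
    have "real v / \<alpha> < real e" using neg assms by (simp add: pos_divide_less_eq mult.commute)
    then have "\<lfloor>real v / \<alpha>\<rfloor> < int e" by (simp add: floor_less_iff)
    moreover have "0 \<le> \<lfloor>real v / \<alpha>\<rfloor>" using assms by simp
    ultimately have "nat \<lfloor>real v / \<alpha>\<rfloor> + 1 \<le> e" by linarith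
    then have "\<alpha> * real (nat \<lfloor>real v / \<alpha>\<rfloor> + 1) \<le> \<alpha> * real e"
      using assms by (intro mult_left_mono of_nat_mono) auto
    then have "real v - \<alpha> * real e \<le> - g v" by (simp add: g_def)
    also have "\<dots> \<le> - Min (g ` {..k})" using v by (simp add: Min_le)
    finally show "real v - \<alpha> * real e \<le> - Min (g ` {..k})" .
  qed
qed

text \<open>
  Each extension witnessing that the current set is not strong lowers the weight over \<open>A\<close> by at least
  a fixed amount; as \<open>A\<close> is strong, this can happen only boundedly often.
\<close>

lemma strong_closure:
  assumes al: "0 < \<alpha>"
  shows "\<exists>L\<ge>1. \<forall>(G :: 'v graph) A a. wf_graph G \<longrightarrow> strong \<alpha> L G A \<longrightarrow> a \<in> verts G \<longrightarrow>
    (\<exists>B. insert a A \<subseteq> B \<and> B \<subseteq> verts G \<and> card (B - A) \<le> L \<and> strong \<alpha> k G B)"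
proof -
  obtain \<eta> where \<eta>: "0 < \<eta>" "\<And>v e. v \<le> k \<Longrightarrow> real v - \<alpha> * real e < 0 \<Longrightarrow> real v - \<alpha> * real e \<le> -\<eta>"
    using negative_weight_gap[OF al] by blast
  \<comment> \<open>Adding \<open>a\<close> alone brings the weight over \<open>A\<close> to at most
    1; after \<open>J\<close> drops by \<eta> it would be negative.\<close>
  obtain J :: nat where "1 / \<eta> < real J" using reals_Archimedean2 by blast
  then have J: "1 < real J * \<eta>" using \<eta>(1) by (simp add: pos_divide_less_eq)
  show ?thesis
  \<comment> \<open>One vertex \<open>a\<close>, and at most \<open>k\<close> vertices for each of
    at most \<open>J\<close> drops.\<close>
  proof (intro exI[of _ "1 + J * k"] conjI allI impI)
    fix G :: "'v graph" and A a
    assume G: "wf_graph G" and A: "strong \<alpha> (1 + J * k) G A" and a: "a \<in> verts G"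
    have fin: "finite (verts G)" using G by (simp add: wf_graph_def)
    have AV: "A \<subseteq> verts G" using A by (simp add: strong_def)
    \<comment> \<open>Either j drops have been made, or a strong superset of admissible size
      exists.\<close>
    have step: "(\<exists>B. insert a A \<subseteq> B \<and> B \<subseteq> verts G \<and> card (B - A) \<le> 1 + j * k \<and> rel_weight \<alpha> G A B \<le> 1 - real j * \<eta>)
      \<or> (\<exists>B. insert a A \<subseteq> B \<and> B \<subseteq> verts G \<and> card (B - A) \<le> 1 + J * k \<and> strong \<alpha> k G B)" if "j \<le> J" for j
      using that
    proof (induction j)
      case 0
      have "card (insert a A - A) \<le> card {a}" by (rule card_mono) auto
      then have 1: "card (insert a A - A) \<le> 1" by simp
      then have "rel_weight \<alpha> G A (insert a A) \<le> 1 - 0"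
        unfolding rel_weight_def using al by (intro diff_mono) auto
      then show ?case using 1 a AV by (intro disjI1 exI[of _ "insert a A"]) auto
    next
      case (Suc j)
      show ?case
      proof (cases "\<exists>B. insert a A \<subseteq> B \<and> B \<subseteq> verts G \<and> card (B - A) \<le> 1 + J * k \<and> strong \<alpha> k G B")
        case False
        then obtain B where B: "insert a A \<subseteq> B" "B \<subseteq> verts G" "card (B - A) \<le> 1 + j * k"
            "rel_weight \<alpha> G A B \<le> 1 - real j * \<eta>"
          using Suc by auto
        have jk: "j * k \<le> J * k" using Suc.prems by (intro mult_right_mono) auto
        then have "card (B - A) \<le> 1 + J * k" using B(3) by linarith
        then have "\<not> strong \<alpha> k G B" using False B(1,2) by blast
        then obtain C where C: "B \<subseteq> C" "C \<subseteq> verts G" "card (C - B) \<le> k" "rel_weight \<alpha> G B C < 0"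
          using B by (auto simp: strong_def not_le)
        have "rel_weight \<alpha> G B C \<le> -\<eta>"
          using \<eta>(2)[OF C(3)] C(4) by (simp add: rel_weight_def)
        moreover have "rel_weight \<alpha> G A C = rel_weight \<alpha> G A B + rel_weight \<alpha> G B C"
          by (rule rel_weight_add[OF G _ C(1,2)]) (use B in auto)
        ultimately have "rel_weight \<alpha> G A C \<le> 1 - real (Suc j) * \<eta>" using B(4) by (simp add: algebra_simps)
        moreover have "card (C - A) \<le> 1 + Suc j * k"
        proof -
          have "card (C - A) \<le> card ((B - A) \<union> (C - B))"
            by (rule card_mono) (use B C fin in \<open>auto intro: finite_subset\<close>)
          also have "\<dots> \<le> card (B - A) + card (C - B)" by (rule card_Un_le)
          finally show ?thesis using B(3) C(3) by simp
        qed
        ultimately show ?thesis using B C by (intro disjI1 exI[of _ C]) auto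
      qed blast
    qed
    have "\<not> (\<exists>B. insert a A \<subseteq> B \<and> B \<subseteq> verts G \<and> card (B - A) \<le> 1 + J * k \<and> rel_weight \<alpha> G A B \<le> 1 - real J * \<eta>)"
    proof
      assume "\<exists>B. insert a A \<subseteq> B \<and> B \<subseteq> verts G \<and> card (B - A) \<le> 1 + J * k \<and> rel_weight \<alpha> G A B \<le> 1 - real J * \<eta>"
      then obtain B where "insert a A \<subseteq> B" "B \<subseteq> verts G" "card (B - A) \<le> 1 + J * k" "rel_weight \<alpha> G A B \<le> 1 - real J * \<eta>"
        by blast
      moreover from this have "0 \<le> rel_weight \<alpha> G A B" using A by (auto simp: strong_def)
      ultimately show False using J by linarith
    qed
    then show "\<exists>B. insert a A \<subseteq> B \<and> B \<subseteq> verts G \<and> card (B - A) \<le> 1 + J * k \<and> strong \<alpha> k G B"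
      using step[of J] by blast
  qed simp
qed

section \<open>Values of terms on strong sets\<close>

lemma lipschitz_funE:
  assumes "lipschitz_fun m f"
  obtains C where "0 \<le> C"
    "\<And>xs ys \<delta>. length xs = m \<Longrightarrow> length ys = m \<Longrightarrow> (\<And>i. i < m \<Longrightarrow> \<bar>xs ! i - ys ! i\<bar> \<le> \<delta>) \<Longrightarrow>
       \<bar>f xs - f ys\<bar> \<le> C * (real m * \<delta>)"
proof -
  obtain C where C: "0 \<le> C" "\<And>xs ys. length xs = m \<Longrightarrow> length ys = m \<Longrightarrow>
      \<bar>f xs - f ys\<bar> \<le> C * L2_set (\<lambda>i. xs ! i - ys ! i) {..<m}"
    using assms by (auto simp: lipschitz_fun_def)
  show ?thesis
  proof (rule that[OF C(1)])
    fix xs ys :: "real list" and \<delta>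
    assume l: "length xs = m" "length ys = m" and \<delta>: "\<And>i. i < m \<Longrightarrow> \<bar>xs ! i - ys ! i\<bar> \<le> \<delta>"
    have "L2_set (\<lambda>i. xs ! i - ys ! i) {..<m} \<le> (\<Sum>i<m. \<bar>xs ! i - ys ! i\<bar>)" by (rule L2_set_le_sum_abs)
    also have "\<dots> \<le> (\<Sum>i<m. \<delta>)" by (rule sum_mono) (use \<delta> in auto)
    finally have "L2_set (\<lambda>i. xs ! i - ys ! i) {..<m} \<le> real m * \<delta>" by simp
    then show "\<bar>f xs - f ys\<bar> \<le> C * (real m * \<delta>)"
      using C(2)[OF l] mult_left_mono[OF _ C(1)] by (meson order_trans)
  qed
qed

lemma abs_average_le:
  fixes D :: "'a \<Rightarrow> real"
  assumes "\<And>a. a \<in> X \<Longrightarrow> \<bar>D a\<bar> \<le> M" "0 \<le> M"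
  shows "\<bar>(\<Sum>a\<in>X. D a) / real (card X)\<bar> \<le> M"
proof (cases "card X = 0")
  case False
  have "\<bar>\<Sum>a\<in>X. D a\<bar> \<le> (\<Sum>a\<in>X. \<bar>D a\<bar>)" by (rule sum_abs)
  also have "\<dots> \<le> (\<Sum>a\<in>X. M)" by (rule sum_mono) (use assms in auto)
  finally show ?thesis using False by (simp add: field_simps)
qed (use assms in simp)

text \<open>Atypical vertices are few, but their share in an average is small only because values
  are bounded, by one constant for all graphs. A Lipschitz function is bounded on bounded sets by
  comparison with its value at 0.\<close>

lemma term_value_bounded:
  "agg_lp_term \<tau> \<Longrightarrow> \<exists>M\<ge>0. \<forall>(G :: 'v graph) \<nu>. finite (verts G) \<longrightarrow> verts G \<noteq> {} \<longrightarrow> \<bar>term_value G \<nu> \<tau>\<bar> \<le> M"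
proof (induction \<tau>)
  case (ConstT c)
  then show ?case by (intro exI[of _ "\<bar>c\<bar>"]) auto
next
  case (EdgeT u v)
  then show ?case by (intro exI[of _ 1]) auto
next
  case (EqT u v)
  then show ?case by (intro exI[of _ 1]) auto
next
  case (FunT f ts)
  have "\<forall>t\<in>set ts. \<exists>M\<ge>0. \<forall>(G :: 'v graph) \<nu>. finite (verts G) \<longrightarrow> verts G \<noteq> {} \<longrightarrow> \<bar>term_value G \<nu> t\<bar> \<le> M"
    using FunT by simp
  then obtain B where B: "\<And>t. t \<in> set ts \<Longrightarrow> 0 \<le> B t \<and> (\<forall>(G :: 'v graph) \<nu>. finite (verts G) \<longrightarrow> verts G \<noteq> {} \<longrightarrow> \<bar>term_value G \<nu> t\<bar> \<le> B t)"
    by metis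
  define M where "M = (\<Sum>t\<in>set ts. B t)"
  have BM: "B t \<le> M" if "t \<in> set ts" for t
    unfolding M_def by (rule member_le_sum) (use B that in auto)
  let ?m = "length ts"
  obtain C where C: "0 \<le> C" "\<And>xs ys \<delta>. length xs = ?m \<Longrightarrow> length ys = ?m \<Longrightarrow> (\<And>i. i < ?m \<Longrightarrow> \<bar>xs ! i - ys ! i\<bar> \<le> \<delta>) \<Longrightarrow>
       \<bar>f xs - f ys\<bar> \<le> C * (real ?m * \<delta>)"
    using FunT.prems lipschitz_funE[of ?m f] by auto
  have M0: "0 \<le> M" unfolding M_def using B by (auto intro: sum_nonneg)
  show ?case
  proof (intro exI[of _ "\<bar>f (replicate ?m 0)\<bar> + C * (real ?m * M)"] conjI allI impI)
    show "0 \<le> \<bar>f (replicate ?m 0)\<bar> + C * (real ?m * M)" using C(1) M0 by simp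
    fix G :: "'v graph" and \<nu> assume G: "finite (verts G)" "verts G \<noteq> {}"
    have "\<bar>f (map (term_value G \<nu>) ts) - f (replicate ?m 0)\<bar> \<le> C * (real ?m * M)"
    proof (rule C(2))
      fix i assume i: "i < ?m"
      then have "ts ! i \<in> set ts" by simp
      then show "\<bar>map (term_value G \<nu>) ts ! i - replicate ?m 0 ! i\<bar> \<le> M"
        using B[of "ts ! i"] BM[of "ts ! i"] G i by (auto intro: order_trans)
    qed auto
    then show "\<bar>term_value G \<nu> (FunT f ts)\<bar> \<le> \<bar>f (replicate ?m 0)\<bar> + C * (real ?m * M)" by simp
  qed
next
  case (AvgT v t)
  then obtain M where M: "0 \<le> M" "\<And>(G :: 'v graph) \<nu>. finite (verts G) \<Longrightarrow> verts G \<noteq> {} \<Longrightarrow> \<bar>term_value G \<nu> t\<bar> \<le> M" by auto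
  show ?case
  proof (intro exI[of _ M] conjI allI impI M(1))
    fix G :: "'v graph" and \<nu> assume G: "finite (verts G)" "verts G \<noteq> {}"
    show "\<bar>term_value G \<nu> (AvgT v t)\<bar> \<le> M"
      unfolding term_value.simps by (rule abs_average_le[OF M(2)[OF G] M(1)])
  qed
next
  case (LAvgT w v t)
  then obtain M where M: "0 \<le> M" "\<And>(G :: 'v graph) \<nu>. finite (verts G) \<Longrightarrow> verts G \<noteq> {} \<Longrightarrow> \<bar>term_value G \<nu> t\<bar> \<le> M" by auto
  show ?case
  proof (intro exI[of _ M] conjI allI impI M(1))
    fix G :: "'v graph" and \<nu> assume G: "finite (verts G)" "verts G \<noteq> {}"
    show "\<bar>term_value G \<nu> (LAvgT w v t)\<bar> \<le> M"
      using abs_average_le[where D = "\<lambda>a. term_value G (\<nu>(v := a)) t" and X = "neighbours G (\<nu> w)", OF M(2)[OF G] M(1)] M(1)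
      by (simp del: abs_divide)
  qed
next
  case (MaxT v t)
  then obtain M where M: "0 \<le> M" "\<And>(G :: 'v graph) \<nu>. finite (verts G) \<Longrightarrow> verts G \<noteq> {} \<Longrightarrow> \<bar>term_value G \<nu> t\<bar> \<le> M" by auto
  show ?case
  proof (intro exI[of _ M] conjI allI impI M(1))
    fix G :: "'v graph" and \<nu> assume G: "finite (verts G)" "verts G \<noteq> {}"
    have "term_value G \<nu> (MaxT v t) \<in> (\<lambda>a. term_value G (\<nu>(v := a)) t) ` verts G"
      unfolding term_value.simps by (rule Max_in) (use G in auto)
    then show "\<bar>term_value G \<nu> (MaxT v t)\<bar> \<le> M" using M(2)[OF G] by auto
  qed
qed

section \<open>Positions of the Ehrenfeucht-Fraisse game\<close>

definition strong_iso :: "real \<Rightarrow> nat \<Rightarrow> nat \<Rightarrow> 'v graph \<Rightarrow> 'v graph \<Rightarrow> (nat \<Rightarrow> 'v) \<Rightarrow> (nat \<Rightarrow> 'v) \<Rightarrow> bool" where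
  "strong_iso \<alpha> k s G H z z' \<longleftrightarrow> inj_on z {..<s} \<and> inj_on z' {..<s} \<and>
     strong \<alpha> k G (z ` {..<s}) \<and> strong \<alpha> k H (z' ` {..<s}) \<and>
     (\<forall>i<s. \<forall>j<s. {z i, z j} \<in> edges G \<longleftrightarrow> {z' i, z' j} \<in> edges H)"

lemma strong_iso_sym: "strong_iso \<alpha> k s G H z z' \<Longrightarrow> strong_iso \<alpha> k s H G z' z"
  by (auto simp: strong_iso_def)

lemma strong_iso_mono: "strong_iso \<alpha> k s G H z z' \<Longrightarrow> k' \<le> k \<Longrightarrow> strong_iso \<alpha> k' s G H z z'"
  by (auto simp: strong_iso_def intro: strong_mono)

lemma no_loop: "wf_graph G \<Longrightarrow> {v} \<notin> edges G"
  using card_vertex_pair[of "{v}" "verts G"] by (auto simp: wf_graph_def)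

text \<open>Edges between roots are matched by \<open>iso\<close>, all others by the template, which
  both copies realise without extra edges.\<close>

lemma strong_iso_extend:
  assumes G: "wf_graph G" "wf_graph H" and iso: "strong_iso \<alpha> k s G H z z'"
    and y: "y \<in> ext_maps (verts G) z s t" "generic \<alpha> k' G s t E y"
    and y': "y' \<in> ext_maps (verts H) z' s t" "generic \<alpha> k' H s t E y'"
  shows "strong_iso \<alpha> k' (s + t) G H y y'"
  unfolding strong_iso_def
proof (intro conjI allI impI)
  fix i j assume i: "i < s + t" and j: "j < s + t"
  consider "i < s" "j < s" | "i = j" | "{i, j} \<in> slots s t"
    using i j by (force simp: slots_def)
  then show "{y i, y j} \<in> edges G \<longleftrightarrow> {y' i, y' j} \<in> edges H"
  proof cases
    case 1
    then show ?thesis using iso y(1) y'(1) by (auto simp: strong_iso_def ext_maps_def)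
  next
    case 2
    then show ?thesis using G by (simp add: no_loop)
  next
    case 3
    have "{i, j} \<in> pull_edges G y s t \<longleftrightarrow> {i, j} \<in> pull_edges H y' s t"
      using y(2) y'(2) by (simp add: generic_def)
    then show ?thesis using 3 by (simp add: pull_edges_def)
  qed
qed (use y y' in \<open>auto simp: ext_maps_def generic_def\<close>)

text \<open>The assignment is factored as \<open>z \<circ> h\<close>: \<open>h\<close> sends
  variables to positions in the strong set, common to both graphs, and \<open>z\<close>,
  \<open>z'\<close> place these positions in the graphs.\<close>

definition approx_determined :: "real \<Rightarrow> nat \<Rightarrow> nat \<Rightarrow> real \<Rightarrow> agg_term \<Rightarrow> 'v graph \<Rightarrow> 'v graph \<Rightarrow> bool" where
  "approx_determined \<alpha> k s \<epsilon> \<tau> G H \<longleftrightarrow> (\<forall>z z' h. strong_iso \<alpha> k s G H z z' \<longrightarrow> (\<forall>x\<in>free_vars \<tau>. h x < s) \<longrightarrow>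
     \<bar>term_value G (z \<circ> h) \<tau> - term_value H (z' \<circ> h) \<tau>\<bar> \<le> \<epsilon>)"

lemma approx_determinedD:
  "approx_determined \<alpha> k s \<epsilon> \<tau> G H \<Longrightarrow> strong_iso \<alpha> k s G H z z' \<Longrightarrow> (\<And>x. x \<in> free_vars \<tau> \<Longrightarrow> h x < s) \<Longrightarrow>
     \<bar>term_value G (z \<circ> h) \<tau> - term_value H (z' \<circ> h) \<tau>\<bar> \<le> \<epsilon>"
  by (auto simp: approx_determined_def)

text \<open>Binding \<open>v\<close> to a vertex of the extension amounts to moving the position
  \<open>h v\<close>, which restores the factored form of the assignment.\<close>

lemma term_value_extend:
  assumes y: "\<And>i. i < s \<Longrightarrow> y i = z i" and h: "\<And>x. x \<in> free_vars \<tau> - {v} \<Longrightarrow> h x < s"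
  shows "term_value G ((z \<circ> h)(v := y j)) \<tau> = term_value G (y \<circ> h(v := j)) \<tau>"
  by (rule term_value_cong) (use assms in auto)

lemma approx_determined_new:
  assumes det: "approx_determined \<alpha> k' (s + t) \<epsilon> \<tau> G H"
    and G: "wf_graph G" "wf_graph H" and iso: "strong_iso \<alpha> k s G H z z'"
    and y: "y \<in> ext_maps (verts G) z s t" "generic \<alpha> k' G s t E y"
    and y': "y' \<in> ext_maps (verts H) z' s t" "generic \<alpha> k' H s t E y'"
    and h: "\<And>x. x \<in> free_vars \<tau> - {v} \<Longrightarrow> h x < s" and j: "j < s + t"
  shows "\<bar>term_value G ((z \<circ> h)(v := y j)) \<tau> - term_value H ((z' \<circ> h)(v := y' j)) \<tau>\<bar> \<le> \<epsilon>"
proof -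
  have "term_value G ((z \<circ> h)(v := y j)) \<tau> = term_value G (y \<circ> h(v := j)) \<tau>"
    by (rule term_value_extend[OF _ h]) (use y in \<open>auto simp: ext_maps_def\<close>)
  moreover have "term_value H ((z' \<circ> h)(v := y' j)) \<tau> = term_value H (y' \<circ> h(v := j)) \<tau>"
    by (rule term_value_extend[OF _ h]) (use y' in \<open>auto simp: ext_maps_def\<close>)
  moreover have "\<bar>term_value G (y \<circ> h(v := j)) \<tau> - term_value H (y' \<circ> h(v := j)) \<tau>\<bar> \<le> \<epsilon>"
    by (rule approx_determinedD[OF det strong_iso_extend[OF G iso y y']])
       (use h j in \<open>auto simp: trans_less_add1\<close>)
  ultimately show ?thesis by simp
qed

section \<open>Averages over one-vertex extensions\<close>

lemma average_near:
  fixes D :: "'a \<Rightarrow> real"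
  assumes X: "finite X" "X \<noteq> {}" and Y: "real (card (X - Y)) \<le> \<beta> * real (card X)"
    and D: "\<And>a. a \<in> X \<Longrightarrow> \<bar>D a\<bar> \<le> M" "\<bar>c\<bar> \<le> M" and near: "\<And>a. a \<in> Y \<Longrightarrow> \<bar>D a - c\<bar> \<le> \<epsilon>" and \<epsilon>: "0 \<le> \<epsilon>"
  shows "\<bar>(\<Sum>a\<in>X. D a) / real (card X) - c\<bar> \<le> \<epsilon> + 2 * M * \<beta>"
proof -
  let ?n = "real (card X)"
  have n: "0 < ?n" using X by (simp add: card_gt_0_iff)
  have M: "0 \<le> M" using D(2) by linarith
  have "\<bar>(\<Sum>a\<in>X. D a) - ?n * c\<bar> = \<bar>\<Sum>a\<in>X. D a - c\<bar>" by (simp add: sum_subtractf)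
  also have "\<dots> \<le> (\<Sum>a\<in>X. \<bar>D a - c\<bar>)" by (rule sum_abs)
  also have "\<dots> \<le> (\<Sum>a\<in>X. \<epsilon> + (if a \<in> X - Y then 2 * M else 0))"
  proof (rule sum_mono)
    fix a assume a: "a \<in> X"
    show "\<bar>D a - c\<bar> \<le> \<epsilon> + (if a \<in> X - Y then 2 * M else 0)"
    proof (cases "a \<in> Y")
      case False
      have "\<bar>D a - c\<bar> \<le> 2 * M" using D(1)[OF a] D(2) by linarith
      then show ?thesis using False a \<epsilon> by simp
    qed (use near in simp)
  qed
  also have "\<dots> = ?n * \<epsilon> + real (card (X - Y)) * (2 * M)"
  proof -
    have "X \<inter> {a. a \<notin> Y} = X - Y" by auto
    then show ?thesis using X by (simp add: sum.distrib sum.If_cases)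
  qed
  also have "\<dots> \<le> ?n * \<epsilon> + (\<beta> * ?n) * (2 * M)"
    using Y M by (intro add_left_mono mult_right_mono) auto
  finally have *: "\<bar>(\<Sum>a\<in>X. D a) - ?n * c\<bar> \<le> ?n * (\<epsilon> + 2 * M * \<beta>)" by (simp add: algebra_simps)
  have "(\<Sum>a\<in>X. D a) / ?n - c = ((\<Sum>a\<in>X. D a) - ?n * c) / ?n" using n by (simp add: field_simps)
  then show ?thesis using * n by (simp add: abs_divide pos_divide_le_eq mult.commute)
qed

text \<open>For t = 1 a copy amounts to its new vertex: the empty template gives all non-roots, and
  \<open>{{i, s}}\<close> the non-root neighbours of \<open>z i\<close>.\<close>

lemma new_vertices_of_copies:
  assumes z: "inj_on z {..<s}" "z ` {..<s} \<subseteq> verts G" and E: "E \<subseteq> slots s 1"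
  shows "(\<lambda>y. y s) ` copies G z s 1 E = {a \<in> verts G - z ` {..<s}. \<forall>e\<in>E. (z(s := a)) ` e \<in> edges G}"
proof (intro equalityI subsetI)
  fix a assume "a \<in> (\<lambda>y. y s) ` copies G z s 1 E"
  then obtain y where y: "y \<in> ext_maps (verts G) z s 1" "edge_image y E \<subseteq> edges G" "a = y s"
    by (auto simp: copies_def)
  have "a \<notin> z ` {..<s}"
  proof
    assume "a \<in> z ` {..<s}"
    then obtain i where "i < s" "y s = y i" using y by (auto simp: ext_maps_def)
    then show False using y(1) inj_onD[of y "{..<s + 1}" s i] by (auto simp: ext_maps_def)
  qed
  moreover have "(z(s := a)) ` e = y ` e" if "e \<in> E" for e
  proof (rule image_cong[OF refl])
    fix i assume "i \<in> e"
    moreover have "e \<subseteq> {..<s + 1}" using that E by (auto simp only: slots_def)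
    ultimately have "i < s \<or> i = s" by auto
    then show "(z(s := a)) i = y i" using y by (auto simp: ext_maps_def)
  qed
  ultimately show "a \<in> {a \<in> verts G - z ` {..<s}. \<forall>e\<in>E. (z(s := a)) ` e \<in> edges G}"
    using y by (auto simp: ext_maps_def edge_image_def)
next
  fix a assume a: "a \<in> {a \<in> verts G - z ` {..<s}. \<forall>e\<in>E. (z(s := a)) ` e \<in> edges G}"
  let ?y = "restrict (z(s := a)) {..<s + 1}"
  have "?y ` e = (z(s := a)) ` e" if "e \<in> E" for e
    using that E by (intro image_cong) (auto simp: slots_def subset_iff)
  then have "edge_image ?y E \<subseteq> edges G" using a by (auto simp: edge_image_def)
  moreover have "?y \<in> ext_maps (verts G) z s 1"
    using a z by (auto simp: ext_maps_def inj_on_def less_Suc_eq image_subset_iff)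
  ultimately show "a \<in> (\<lambda>y. y s) ` copies G z s 1 E"
    by (intro image_eqI[of _ _ ?y]) (auto simp: copies_def)
qed

lemma inj_on_new_vertex: "inj_on (\<lambda>y. y s) (ext_maps V z s 1)"
proof (rule inj_onI)
  fix y y' assume y: "y \<in> ext_maps V z s 1" "y' \<in> ext_maps V z s 1" "y s = y' s"
  show "y = y'"
  proof
    fix i
    consider "i < s" | "i = s" | "\<not> i < s + 1" by linarith
    then show "y i = y' i"
      using y by cases (auto simp: ext_maps_def PiE_def extensional_def)
  qed
qed

text \<open>Among N copies at most \<zeta> * N are nongeneric, and the at most s roots in
  \<open>X\<close> number at most s * \<zeta> * N since \<zeta> * N \<ge> 1; hence the factor s +
  1.\<close>

lemma average_over_copies:
  fixes D :: "'v \<Rightarrow> real"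
  assumes G: "wf_graph G" and ext: "gen_ext \<alpha> s 1 E k \<zeta> G" and \<zeta>: "0 < \<zeta>"
    and z: "inj_on z {..<s}" "strong \<alpha> (1 + k) G (z ` {..<s})"
    and X: "X \<subseteq> verts G" "X - z ` {..<s} = (\<lambda>y. y s) ` copies G z s 1 E"
    and D: "\<And>a. a \<in> X \<Longrightarrow> \<bar>D a\<bar> \<le> M" "\<bar>c\<bar> \<le> M" and \<epsilon>: "0 \<le> \<epsilon>"
    and near: "\<And>y. y \<in> copies G z s 1 E \<Longrightarrow> generic \<alpha> k G s 1 E y \<Longrightarrow> \<bar>D (y s) - c\<bar> \<le> \<epsilon>"
  shows "X \<noteq> {}" "\<bar>(\<Sum>a\<in>X. D a) / real (card X) - c\<bar> \<le> \<epsilon> + 2 * M * ((real s + 1) * \<zeta>)"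
proof -
  let ?N = "real (card (copies G z s 1 E))"
  let ?bad = "{y \<in> copies G z s 1 E. \<not> generic \<alpha> k G s 1 E y}"
  let ?Y = "(\<lambda>y. y s) ` {y \<in> copies G z s 1 E. generic \<alpha> k G s 1 E y}"
  have finV: "finite (verts G)" using G by (simp add: wf_graph_def)
  have finX: "finite X" using finite_subset[OF X(1) finV] .
  have bad: "real (card ?bad) \<le> \<zeta> * ?N" and N: "1 / \<zeta> \<le> ?N"
    using ext z unfolding gen_ext_def by blast+
  have N1: "1 \<le> \<zeta> * ?N" using N \<zeta> by (simp add: field_simps)
  have "card (copies G z s 1 E) = card ((\<lambda>y. y s) ` copies G z s 1 E)"
    by (rule card_image[symmetric], rule inj_on_subset[OF inj_on_new_vertex]) (auto simp: copies_def)
  also have "\<dots> \<le> card X" using finX X(2) by (intro card_mono) auto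
  finally have NX: "?N \<le> real (card X)" by simp
  have "0 < ?N" using N \<zeta> by (meson divide_pos_pos less_le_trans zero_less_one)
  then show ne: "X \<noteq> {}" using NX by auto
  have "real (card (X - ?Y)) \<le> (real s + 1) * \<zeta> * real (card X)"
  proof -
    have "X - ?Y \<subseteq> z ` {..<s} \<union> (\<lambda>y. y s) ` ?bad"
    proof
      fix a assume a: "a \<in> X - ?Y"
      show "a \<in> z ` {..<s} \<union> (\<lambda>y. y s) ` ?bad"
      proof (cases "a \<in> z ` {..<s}")
        case False
        then have "a \<in> (\<lambda>y. y s) ` copies G z s 1 E" using a X(2) by blast
        then show ?thesis using a by blast
      qed simp
    qed
    then have "card (X - ?Y) \<le> card (z ` {..<s} \<union> (\<lambda>y. y s) ` ?bad)"
      by (rule card_mono[rotated]) (simp add: finite_copies[OF finV])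
    also have "\<dots> \<le> card (z ` {..<s}) + card ((\<lambda>y. y s) ` ?bad)" by (rule card_Un_le)
    also have "\<dots> \<le> s + card ?bad"
      using card_image_le[of "{..<s}" z] card_image_le[of ?bad "\<lambda>y. y s"] finite_copies[OF finV]
      by (intro add_mono) auto
    finally have "real (card (X - ?Y)) \<le> real s + real (card ?bad)" by linarith
    also have "\<dots> \<le> real s * (\<zeta> * ?N) + \<zeta> * ?N"
      using bad mult_left_mono[OF N1, of "real s"] by simp
    also have "\<dots> = (real s + 1) * \<zeta> * ?N" by (simp add: algebra_simps)
    also have "\<dots> \<le> (real s + 1) * \<zeta> * real (card X)"
      using NX \<zeta> by (intro mult_left_mono) auto
    finally show ?thesis .
  qed
  then show "\<bar>(\<Sum>a\<in>X. D a) / real (card X) - c\<bar> \<le> \<epsilon> + 2 * M * ((real s + 1) * \<zeta>)"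
    by (rule average_near[where D = D and c = c, OF finX ne]) (use D \<epsilon> near in auto)
qed

lemma gen_ext_generic_copy:
  assumes G: "finite (verts G)" and ext: "gen_ext \<alpha> s t E k \<zeta> G" and \<zeta>: "0 < \<zeta>" "\<zeta> < 1"
    and z: "inj_on z {..<s}" "strong \<alpha> (t + k) G (z ` {..<s})"
  shows "\<exists>y\<in>copies G z s t E. generic \<alpha> k G s t E y"
proof (rule ccontr)
  assume "\<not> ?thesis"
  then have "{y \<in> copies G z s t E. \<not> generic \<alpha> k G s t E y} = copies G z s t E" by auto
  moreover have "real (card {y \<in> copies G z s t E. \<not> generic \<alpha> k G s t E y}) \<le> \<zeta> * real (card (copies G z s t E))"
    and N: "1 / \<zeta> \<le> real (card (copies G z s t E))"
    using ext z unfolding gen_ext_def by blast+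
  ultimately have "real (card (copies G z s t E)) \<le> \<zeta> * real (card (copies G z s t E))" by (simp only:)
  moreover have "0 < real (card (copies G z s t E))"
    using N \<zeta>(1) by (meson divide_pos_pos less_le_trans zero_less_one)
  ultimately show False using mult_strict_right_mono[OF \<zeta>(2), of "real (card (copies G z s t E))"] by linarith
qed

text \<open>Each average is compared with the value at a fixed generic copy in the other graph, and
  these two values with each other, whence 3 * \<epsilon>. Nonemptiness is recorded because a local
  average over no neighbours is 0 by convention.\<close>

lemma averages_close:
  assumes det: "approx_determined \<alpha> k (s + 1) \<epsilon> \<tau> G H" "approx_determined \<alpha> k (s + 1) \<epsilon> \<tau> H G"
    and G: "wf_graph G" "wf_graph H"
    and ext: "gen_ext \<alpha> s 1 E k \<zeta> G" "gen_ext \<alpha> s 1 E k \<zeta> H" and \<zeta>: "0 < \<zeta>" "\<zeta> < 1"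
    and iso: "strong_iso \<alpha> (1 + k) s G H z z'"
    and X: "X \<subseteq> verts G" "X - z ` {..<s} = (\<lambda>y. y s) ` copies G z s 1 E"
    and X': "X' \<subseteq> verts H" "X' - z' ` {..<s} = (\<lambda>y. y s) ` copies H z' s 1 E"
    and h: "\<And>x. x \<in> free_vars \<tau> - {v} \<Longrightarrow> h x < s" and \<epsilon>: "0 \<le> \<epsilon>"
    and M: "\<And>\<nu>. \<bar>term_value G \<nu> \<tau>\<bar> \<le> M" "\<And>\<nu>. \<bar>term_value H \<nu> \<tau>\<bar> \<le> M"
  shows "X \<noteq> {}" "X' \<noteq> {}"
    "\<bar>(\<Sum>a\<in>X. term_value G ((z \<circ> h)(v := a)) \<tau>) / real (card X)
      - (\<Sum>a\<in>X'. term_value H ((z' \<circ> h)(v := a)) \<tau>) / real (card X')\<bar> \<le> 3 * \<epsilon> + 4 * M * ((real s + 1) * \<zeta>)"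
proof -
  let ?D = "\<lambda>a. term_value G ((z \<circ> h)(v := a)) \<tau>" and ?D' = "\<lambda>a. term_value H ((z' \<circ> h)(v := a)) \<tau>"
  have fin: "finite (verts G)" "finite (verts H)" using G by (auto simp: wf_graph_def)
  have z: "inj_on z {..<s}" "strong \<alpha> (1 + k) G (z ` {..<s})" "inj_on z' {..<s}" "strong \<alpha> (1 + k) H (z' ` {..<s})"
    using iso by (auto simp: strong_iso_def)
  have near: "\<bar>?D (y s) - ?D' (y' s)\<bar> \<le> \<epsilon>"
    if "y \<in> copies G z s 1 E" "generic \<alpha> k G s 1 E y" "y' \<in> copies H z' s 1 E" "generic \<alpha> k H s 1 E y'" for y y'
    by (rule approx_determined_new[OF det(1) G iso _ that(2) _ that(4) h]) (use that in \<open>auto simp: copies_def\<close>)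
  obtain y where y: "y \<in> copies G z s 1 E" "generic \<alpha> k G s 1 E y"
    using gen_ext_generic_copy[OF fin(1) ext(1) \<zeta> z(1,2)] by blast
  obtain y' where y': "y' \<in> copies H z' s 1 E" "generic \<alpha> k H s 1 E y'"
    using gen_ext_generic_copy[OF fin(2) ext(2) \<zeta> z(3,4)] by blast
  note 1 = average_over_copies[OF G(1) ext(1) \<zeta>(1) z(1,2) X, of ?D M "?D' (y' s)" \<epsilon>]
  note 2 = average_over_copies[OF G(2) ext(2) \<zeta>(1) z(3,4) X', of ?D' M "?D (y s)" \<epsilon>]
  show "X \<noteq> {}" by (rule 1(1)) (use M \<epsilon> near y' in auto)
  show "X' \<noteq> {}" by (rule 2(1)) (use M \<epsilon> near y in \<open>auto simp: abs_minus_commute\<close>)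
  have "\<bar>(\<Sum>a\<in>X. ?D a) / real (card X) - ?D' (y' s)\<bar> \<le> \<epsilon> + 2 * M * ((real s + 1) * \<zeta>)"
    by (rule 1(2)) (use M \<epsilon> near y' in auto)
  moreover have "\<bar>(\<Sum>a\<in>X'. ?D' a) / real (card X') - ?D (y s)\<bar> \<le> \<epsilon> + 2 * M * ((real s + 1) * \<zeta>)"
    by (rule 2(2)) (use M \<epsilon> near y in \<open>auto simp: abs_minus_commute\<close>)
  moreover have "\<bar>?D (y s) - ?D' (y' s)\<bar> \<le> \<epsilon>" by (rule near[OF y y'])
  ultimately show "\<bar>(\<Sum>a\<in>X. ?D a) / real (card X) - (\<Sum>a\<in>X'. ?D' a) / real (card X')\<bar> \<le> 3 * \<epsilon> + 4 * M * ((real s + 1) * \<zeta>)"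
    by linarith
qed

section \<open>Answering a vertex chosen by the maximum\<close>

lemma Max_image_le:
  fixes f :: "'a \<Rightarrow> real"
  assumes "finite A" "A \<noteq> {}" "finite B" "\<And>a. a \<in> A \<Longrightarrow> \<exists>b\<in>B. f a \<le> g b + \<epsilon>"
  shows "Max (f ` A) \<le> Max (g ` B) + \<epsilon>"
proof -
  have "Max (f ` A) \<in> f ` A" using assms by (intro Max_in) auto
  then obtain a where a: "a \<in> A" "Max (f ` A) = f a" by auto
  obtain b where b: "b \<in> B" "f a \<le> g b + \<epsilon>" using assms(4)[OF a(1)] by blast
  have "g b \<le> Max (g ` B)" using b assms(3) by (intro Max_ge) auto
  then show ?thesis using a b by linarith
qed

lemma matching_witness:
  fixes G H :: "'v graph"
  assumes irr: "\<alpha> \<notin> \<rat>" and G: "wf_graph G" "wf_graph H"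
    and L: "\<And>(G :: 'v graph) A a. wf_graph G \<Longrightarrow> strong \<alpha> L G A \<Longrightarrow> a \<in> verts G \<Longrightarrow>
      \<exists>B. insert a A \<subseteq> B \<and> B \<subseteq> verts G \<and> card (B - A) \<le> L \<and> strong \<alpha> k G B"
    and det: "\<And>t. t \<le> L \<Longrightarrow> approx_determined \<alpha> k (s + t) \<epsilon> \<tau> G H"
    and ext: "\<And>t E. 1 \<le> t \<Longrightarrow> t \<le> L \<Longrightarrow> safe \<alpha> s t E \<Longrightarrow> gen_ext \<alpha> s t E k (1 / 2) H"
    and iso: "strong_iso \<alpha> (L + k) s G H z z'"
    and h: "\<And>x. x \<in> free_vars \<tau> - {v} \<Longrightarrow> h x < s" and a: "a \<in> verts G"
  shows "\<exists>a'\<in>verts H. \<bar>term_value G ((z \<circ> h)(v := a)) \<tau> - term_value H ((z' \<circ> h)(v := a')) \<tau>\<bar> \<le> \<epsilon>"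
proof -
  let ?A = "z ` {..<s}"
  have z: "inj_on z {..<s}" "strong \<alpha> (L + k) G ?A" and z': "inj_on z' {..<s}" "strong \<alpha> (L + k) H (z' ` {..<s})"
    using iso by (auto simp: strong_iso_def)
  have fin: "finite (verts G)" "finite (verts H)" using G by (auto simp: wf_graph_def)
  show ?thesis
  \<comment> \<open>A root is answered by the corresponding root; otherwise the closure has a new
    vertex, and the counting for t \<ge> 1 applies.\<close>
  proof (cases "a \<in> ?A")
    case True
    then obtain j where j: "j < s" "a = z j" by auto
    have "term_value G ((z \<circ> h)(v := z j)) \<tau> = term_value G (z \<circ> h(v := j)) \<tau>"
      "term_value H ((z' \<circ> h)(v := z' j)) \<tau> = term_value H (z' \<circ> h(v := j)) \<tau>"
      by (rule term_value_extend[OF _ h]; simp)+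
    moreover have "approx_determined \<alpha> k s \<epsilon> \<tau> G H" using det[of 0] by simp
    from approx_determinedD[OF this strong_iso_mono[OF iso], of "h(v := j)"]
    have "\<bar>term_value G (z \<circ> h(v := j)) \<tau> - term_value H (z' \<circ> h(v := j)) \<tau>\<bar> \<le> \<epsilon>" using h j by auto
    moreover have "z' j \<in> verts H" using z'(2) j by (auto simp: strong_def)
    ultimately show ?thesis using j by (intro bexI[of _ "z' j"]) simp_all
  next
    case False
    obtain B where B: "insert a ?A \<subseteq> B" "B \<subseteq> verts G" "card (B - ?A) \<le> L" "strong \<alpha> k G B"
      using L[OF G(1) strong_mono[OF z(2)] a] by auto
    have finB: "finite B" using finite_subset[OF B(2) fin(1)] .
    define t where "t = card (B - ?A)"
    have t: "1 \<le> t" "t \<le> L"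
      using B False finB by (auto simp: t_def Suc_le_eq card_gt_0_iff)
    obtain y where y: "inj_on y {..<s + t}" "y ` {..<s + t} = B" "\<And>i. i < s \<Longrightarrow> y i = z i" "y \<in> extensional {..<s + t}"
      using extend_enumeration[OF z(1) finB _ t_def[symmetric]] B(1) by auto
    have ym: "y \<in> ext_maps (verts G) z s t"
      using y B(2) by (auto simp: ext_maps_def PiE_def)
    let ?E = "pull_edges G y s t"
    have "safe \<alpha> s t ?E"
      by (rule safe_pull_edges[OF G(1) irr strong_mono[OF z(2)] _ ym, of L]) (use t in auto)
    \<comment> \<open>Here \<zeta> = 1 / 2 suffices, since a single generic copy is wanted.\<close>
    then have "gen_ext \<alpha> s t ?E k (1 / 2) H" using ext t by blast
    then obtain y' where y': "y' \<in> copies H z' s t ?E" "generic \<alpha> k H s t ?E y'"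
      using gen_ext_generic_copy[OF fin(2), of \<alpha> s t ?E k "1 / 2" z'] strong_mono[OF z'(2), of "t + k"] z'(1) t by auto
    obtain j where j: "j < s + t" "y j = a" using y(2) B(1) by auto
    have "generic \<alpha> k G s t ?E y" using B(4) y(2) by (simp add: generic_def)
    then have "\<bar>term_value G ((z \<circ> h)(v := y j)) \<tau> - term_value H ((z' \<circ> h)(v := y' j)) \<tau>\<bar> \<le> \<epsilon>"
      by (intro approx_determined_new[OF det[OF t(2)] G iso ym _ _ y'(2) h j(1)]) (use y' in \<open>auto simp: copies_def\<close>)
    moreover have "y' j \<in> verts H" using y' j(1) by (auto simp: copies_def ext_maps_def)
    ultimately show ?thesis using j by blast
  qed
qed

text \<open>
  The level \<open>k\<close> must not depend on \<open>s\<close>: for \<open>Max\<close>, the induction hypothesis is applied to sets whose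
  size depends on its own \<open>k\<close>.
\<close>

definition whp_determined :: "real \<Rightarrow> agg_term \<Rightarrow> bool" where
  "whp_determined \<alpha> \<tau> \<longleftrightarrow> (\<forall>\<epsilon>>0. \<exists>k. \<forall>s. \<exists>Q. whp \<alpha> Q \<and> (\<forall>G H. Q G \<longrightarrow> Q H \<longrightarrow> approx_determined \<alpha> k s \<epsilon> \<tau> G H))"

lemma safe_isolated: "safe \<alpha> s 1 {}"
  by (auto simp: safe_def tweight_def card_gt_0_iff intro: finite_subset)

text \<open>The only use of \<alpha> < 1: a pendant edge has weight 1 - \<alpha>.\<close>

lemma safe_pendant:
  assumes "\<alpha> < 1" "i < s"
  shows "{{i, s}} \<subseteq> slots s 1" "safe \<alpha> s 1 {{i, s}}"
proof -
  show E: "{{i, s}} \<subseteq> slots s 1" using assms by (auto simp: slots_def)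
  have "0 < tweight \<alpha> s {{i, s}} S" if S: "S \<subseteq> {s..<s + 1}" "S \<noteq> {}" for S
  proof -
    have "S = {s}" using S by auto
    moreover have "{e \<in> {{i, s}}. e \<subseteq> {..<s} \<union> {s}} = {{i, s}}" using assms by auto
    ultimately show ?thesis using assms by (simp add: tweight_def)
  qed
  then show "safe \<alpha> s 1 {{i, s}}" using E by (auto simp: safe_def)
qed

text \<open>One notion for both averages: \<open>X\<close> and \<open>X'\<close> are prescribed only
  off the roots, so they may be vertex sets or neighbourhoods, whatever edges run between
  roots.\<close>

definition averages_determined ::
  "real \<Rightarrow> nat \<Rightarrow> nat \<Rightarrow> real \<Rightarrow> agg_term \<Rightarrow> nat set set \<Rightarrow> 'v graph \<Rightarrow> 'v graph \<Rightarrow> bool" where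
  "averages_determined \<alpha> k s \<epsilon> \<tau> E G H \<longleftrightarrow> (\<forall>z z' h X X' v. strong_iso \<alpha> k s G H z z' \<longrightarrow> (\<forall>x\<in>free_vars \<tau> - {v}. h x < s) \<longrightarrow>
     X \<subseteq> verts G \<longrightarrow> X - z ` {..<s} = (\<lambda>y. y s) ` copies G z s 1 E \<longrightarrow>
     X' \<subseteq> verts H \<longrightarrow> X' - z' ` {..<s} = (\<lambda>y. y s) ` copies H z' s 1 E \<longrightarrow> X \<noteq> {} \<and> X' \<noteq> {} \<and>
     \<bar>(\<Sum>a\<in>X. term_value G ((z \<circ> h)(v := a)) \<tau>) / real (card X)
      - (\<Sum>a\<in>X'. term_value H ((z' \<circ> h)(v := a)) \<tau>) / real (card X')\<bar> \<le> \<epsilon>)"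

lemma averages_determinedD:
  assumes "averages_determined \<alpha> k s \<epsilon> \<tau> E G H" "strong_iso \<alpha> k s G H z z'"
    and "\<And>x. x \<in> free_vars \<tau> - {v} \<Longrightarrow> h x < s"
    and "X \<subseteq> verts G" "X - z ` {..<s} = (\<lambda>y. y s) ` copies G z s 1 E"
    and "X' \<subseteq> verts H" "X' - z' ` {..<s} = (\<lambda>y. y s) ` copies H z' s 1 E"
  shows "X \<noteq> {}" "X' \<noteq> {}"
    "\<bar>(\<Sum>a\<in>X. term_value G ((z \<circ> h)(v := a)) \<tau>) / real (card X)
      - (\<Sum>a\<in>X'. term_value H ((z' \<circ> h)(v := a)) \<tau>) / real (card X')\<bar> \<le> \<epsilon>"
  using assms unfolding averages_determined_def by blast+

text \<open>The level grows by 1, for the vertex bound by the average, and stays independent of s. A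
  finite family of templates is handled at once because a local average may be centred at any
  position.\<close>

lemma whp_determined_average:
  assumes al: "0 < \<alpha>" "\<alpha> \<notin> \<rat>" and \<tau>: "agg_lp_term \<tau>" "whp_determined \<alpha> \<tau>" and \<epsilon>: "0 < \<epsilon>"
  shows "\<exists>k. \<forall>s \<E>. finite \<E> \<longrightarrow> (\<forall>E\<in>\<E>. safe \<alpha> s 1 E) \<longrightarrow>
    (\<exists>Q. whp \<alpha> Q \<and> (\<forall>G H E. Q G \<longrightarrow> Q H \<longrightarrow> E \<in> \<E> \<longrightarrow> averages_determined \<alpha> k s \<epsilon> \<tau> E G H))"
proof -
  obtain M where M: "0 \<le> M" "\<And>(G :: nat graph) \<nu>. finite (verts G) \<Longrightarrow> verts G \<noteq> {} \<Longrightarrow> \<bar>term_value G \<nu> \<tau>\<bar> \<le> M"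
    using term_value_bounded[OF \<tau>(1)] by metis
  \<comment> \<open>Half of the error goes into 3 * (\<epsilon> / 6), the other half into the
    exceptional vertices, via \<open>\<zeta>\<close>.\<close>
  have "0 < \<epsilon> / 6" using \<epsilon> by simp
  then obtain k where k: "\<And>s. \<exists>Q. whp \<alpha> Q \<and> (\<forall>G H. Q G \<longrightarrow> Q H \<longrightarrow> approx_determined \<alpha> k s (\<epsilon> / 6) \<tau> G H)"
    using \<tau>(2) unfolding whp_determined_def by blast
  show ?thesis
  proof (intro exI[of _ "1 + k"] allI impI)
    fix s and \<E> :: "nat set set set" assume fin\<E>: "finite \<E>" and safe: "\<forall>E\<in>\<E>. safe \<alpha> s 1 E"
    obtain Q where Q: "whp \<alpha> Q" "\<And>G H. Q G \<Longrightarrow> Q H \<Longrightarrow> approx_determined \<alpha> k (s + 1) (\<epsilon> / 6) \<tau> G H"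
      using k[of "s + 1"] by blast
    \<comment> \<open>M + 1 keeps the denominator positive when \<open>M\<close> is 0; the cap 1 / 2
      guarantees a generic copy.\<close>
    define \<zeta> where "\<zeta> = min (1 / 2) (\<epsilon> / (8 * (M + 1) * (real s + 1)))"
    have \<zeta>: "0 < \<zeta>" "\<zeta> < 1" using \<epsilon> M(1) by (auto simp: \<zeta>_def)
    have "4 * M * ((real s + 1) * \<zeta>) \<le> 4 * (M + 1) * ((real s + 1) * (\<epsilon> / (8 * (M + 1) * (real s + 1))))"
      using M(1) \<zeta> by (intro mult_mono) (auto simp: \<zeta>_def)
    also have "\<dots> = \<epsilon> / 2"
    proof -
      have "M + 1 \<noteq> 0" "real s + 1 \<noteq> 0" using M(1) by linarith+
      then show ?thesis by (simp add: divide_simps)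
    qed
    finally have err: "3 * (\<epsilon> / 6) + 4 * M * ((real s + 1) * \<zeta>) \<le> \<epsilon>" by linarith
    let ?Q = "\<lambda>G. (wf_graph G \<and> 1 \<le> card (verts G)) \<and> Q G \<and> (\<forall>E\<in>\<E>. gen_ext \<alpha> s 1 E k \<zeta> G)"
    show "\<exists>Q. whp \<alpha> Q \<and> (\<forall>G H E. Q G \<longrightarrow> Q H \<longrightarrow> E \<in> \<E> \<longrightarrow> averages_determined \<alpha> (1 + k) s \<epsilon> \<tau> E G H)"
    proof (rule exI[of _ ?Q], intro conjI allI impI)
      show "whp \<alpha> ?Q"
        by (intro whp_conj[OF whp_wf_graph] whp_conj[OF Q(1)] whp_ball_finite[OF fin\<E>] whp_gen_ext[OF al _ _ \<zeta>(1)])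
           (use safe in auto)
      fix G H E
      assume QG: "?Q G" and QH: "?Q H" and E: "E \<in> \<E>"
      show "averages_determined \<alpha> (1 + k) s \<epsilon> \<tau> E G H"
        unfolding averages_determined_def
      proof (intro allI impI)
        fix z z' h X X' v
        assume iso: "strong_iso \<alpha> (1 + k) s G H z z'"
          and h: "\<forall>x\<in>free_vars \<tau> - {v}. h x < s"
          and X: "X \<subseteq> verts G" "X - z ` {..<s} = (\<lambda>y. y s) ` copies G z s 1 E"
          and X': "X' \<subseteq> verts H" "X' - z' ` {..<s} = (\<lambda>y. y s) ` copies H z' s 1 E"
        have wf: "wf_graph G" "wf_graph H" using QG QH by auto
        have ne: "verts G \<noteq> {}" "verts H \<noteq> {}" using QG QH by auto
        have "\<And>\<nu>. \<bar>term_value G \<nu> \<tau>\<bar> \<le> M" "\<And>\<nu>. \<bar>term_value H \<nu> \<tau>\<bar> \<le> M"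
          using M(2) ne wf by (auto simp: wf_graph_def)
        note c = averages_close[OF Q(2) Q(2) wf _ _ \<zeta> iso X X' _ _ this, of v h]
        show "X \<noteq> {} \<and> X' \<noteq> {} \<and>
          \<bar>(\<Sum>a\<in>X. term_value G ((z \<circ> h)(v := a)) \<tau>) / real (card X)
          - (\<Sum>a\<in>X'. term_value H ((z' \<circ> h)(v := a)) \<tau>) / real (card X')\<bar> \<le> \<epsilon>"
          by (intro conjI c(1) c(2) order_trans[OF c(3) err]) (use QG QH E h \<epsilon> in auto)
      qed
    qed
  qed
qed

text \<open>The level grows with the term: by 1 for an average, by the closure bound
  \<open>L\<close> for a maximum; for a function it is a common bound for the levels of the
  arguments.\<close>

lemma agg_lp_term_determined:
  assumes al: "0 < \<alpha>" "\<alpha> < 1" "\<alpha> \<notin> \<rat>"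
  shows "agg_lp_term \<tau> \<Longrightarrow> whp_determined \<alpha> \<tau>"
proof (induction \<tau>)
  case (ConstT c)
  then show ?case
    unfolding whp_determined_def approx_determined_def by (auto intro!: exI[of _ "\<lambda>_. True"] whp_True)
next
  case (EdgeT u v)
  then show ?case
    unfolding whp_determined_def approx_determined_def strong_iso_def
    by (auto intro!: exI[of _ "\<lambda>_. True"] whp_True)
next
  case (EqT u v)
  have "approx_determined \<alpha> 0 s \<epsilon> (EqT u v) G H" if "0 < \<epsilon>" for s \<epsilon> and G H :: "nat graph"
    unfolding approx_determined_def
  proof (intro allI impI)
    fix z z' h assume iso: "strong_iso \<alpha> 0 s G H z z'" and "\<forall>x\<in>free_vars (EqT u v). h x < s"
    then have "h u < s" "h v < s" by auto
    then have "z (h u) = z (h v) \<longleftrightarrow> h u = h v" "z' (h u) = z' (h v) \<longleftrightarrow> h u = h v"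
      using iso by (auto simp: strong_iso_def inj_on_eq_iff)
    then show "\<bar>term_value G (z \<circ> h) (EqT u v) - term_value H (z' \<circ> h) (EqT u v)\<bar> \<le> \<epsilon>"
      using that by simp
  qed
  then show ?case
    unfolding whp_determined_def by (auto intro!: exI[of _ "\<lambda>_. True"] exI[of _ 0] whp_True)
next
  case (FunT f ts)
  let ?m = "length ts"
  obtain C where C: "0 \<le> C" "\<And>xs ys \<delta>. length xs = ?m \<Longrightarrow> length ys = ?m \<Longrightarrow> (\<And>i. i < ?m \<Longrightarrow> \<bar>xs ! i - ys ! i\<bar> \<le> \<delta>) \<Longrightarrow>
       \<bar>f xs - f ys\<bar> \<le> C * (real ?m * \<delta>)"
    using FunT.prems lipschitz_funE[of ?m f] by auto
  show ?case
    unfolding whp_determined_def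
  proof (intro allI impI)
    fix \<epsilon> :: real assume \<epsilon>: "0 < \<epsilon>"
    \<comment> \<open>The summand 1 keeps the denominator positive when \<open>C\<close> is
      0.\<close>
    define \<delta> where "\<delta> = \<epsilon> / (C * real ?m + 1)"
    have Cm: "0 \<le> C * real ?m" using C(1) by simp
    have \<delta>: "0 < \<delta>" "C * (real ?m * \<delta>) \<le> \<epsilon>"
      using \<epsilon> Cm by (auto simp: \<delta>_def add_nonneg_pos pos_divide_le_eq algebra_simps)
    have "\<forall>t\<in>set ts. \<exists>k. \<forall>s. \<exists>Q. whp \<alpha> Q \<and> (\<forall>G H. Q G \<longrightarrow> Q H \<longrightarrow> approx_determined \<alpha> k s \<delta> t G H)"
      using FunT \<delta>(1) by (auto simp: whp_determined_def)
    then obtain K where K: "\<And>t s. t \<in> set ts \<Longrightarrow> \<exists>Q. whp \<alpha> Q \<and> (\<forall>G H. Q G \<longrightarrow> Q H \<longrightarrow> approx_determined \<alpha> (K t) s \<delta> t G H)"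
      by metis
    define k where "k = (\<Sum>t\<in>set ts. K t)"
    have Kk: "K t \<le> k" if "t \<in> set ts" for t
      unfolding k_def by (rule member_le_sum) (use that in auto)
    show "\<exists>k. \<forall>s. \<exists>Q. whp \<alpha> Q \<and> (\<forall>G H. Q G \<longrightarrow> Q H \<longrightarrow> approx_determined \<alpha> k s \<epsilon> (FunT f ts) G H)"
    proof (intro exI[of _ k] allI)
      fix s
      obtain Q where Q: "\<And>t. t \<in> set ts \<Longrightarrow> whp \<alpha> (Q t) \<and> (\<forall>G H. Q t G \<longrightarrow> Q t H \<longrightarrow> approx_determined \<alpha> (K t) s \<delta> t G H)"
        using K[of _ s] by metis
      show "\<exists>Q. whp \<alpha> Q \<and> (\<forall>G H. Q G \<longrightarrow> Q H \<longrightarrow> approx_determined \<alpha> k s \<epsilon> (FunT f ts) G H)"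
      proof (intro exI[of _ "\<lambda>G. \<forall>t\<in>set ts. Q t G"] conjI allI impI)
        show "whp \<alpha> (\<lambda>G. \<forall>t\<in>set ts. Q t G)" by (rule whp_ball_finite) (use Q in auto)
        fix G H assume GH: "\<forall>t\<in>set ts. Q t G" "\<forall>t\<in>set ts. Q t H"
        show "approx_determined \<alpha> k s \<epsilon> (FunT f ts) G H"
          unfolding approx_determined_def term_value.simps
        proof (intro allI impI order_trans[OF C(2) \<delta>(2)])
          fix z z' h i
          assume iso: "strong_iso \<alpha> k s G H z z'" and h: "\<forall>x\<in>free_vars (FunT f ts). h x < s" and i: "i < ?m"
          then have t: "ts ! i \<in> set ts" by simp
          have "approx_determined \<alpha> (K (ts ! i)) s \<delta> (ts ! i) G H" using Q[OF t] GH t by blast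
          moreover have "h x < s" if "x \<in> free_vars (ts ! i)" for x using h t that by auto
          ultimately have "\<bar>term_value G (z \<circ> h) (ts ! i) - term_value H (z' \<circ> h) (ts ! i)\<bar> \<le> \<delta>"
            using approx_determinedD[OF _ strong_iso_mono[OF iso Kk[OF t]]] by blast
          then show "\<bar>map (term_value G (z \<circ> h)) ts ! i - map (term_value H (z' \<circ> h)) ts ! i\<bar> \<le> \<delta>"
            using i by simp
        qed auto
      qed
    qed
  qed
next
  case (AvgT v t)
  then have t: "agg_lp_term t" "whp_determined \<alpha> t" by auto
  show ?case
    unfolding whp_determined_def
  proof (intro allI impI)
    fix \<epsilon> :: real assume \<epsilon>: "0 < \<epsilon>"
    obtain k where k: "\<And>s \<E>. finite \<E> \<Longrightarrow> (\<forall>E\<in>\<E>. safe \<alpha> s 1 E) \<Longrightarrow>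
        \<exists>Q. whp \<alpha> Q \<and> (\<forall>G H E. Q G \<longrightarrow> Q H \<longrightarrow> E \<in> \<E> \<longrightarrow> averages_determined \<alpha> k s \<epsilon> t E G H)"
      using whp_determined_average[OF al(1,3) t \<epsilon>] by blast
    show "\<exists>k. \<forall>s. \<exists>Q. whp \<alpha> Q \<and> (\<forall>G H. Q G \<longrightarrow> Q H \<longrightarrow> approx_determined \<alpha> k s \<epsilon> (AvgT v t) G H)"
    proof (intro exI[of _ k] allI)
      fix s
      \<comment> \<open>The new vertices of copies of the empty template are all vertices but the
        roots.\<close>
      have "\<forall>E\<in>{{}}. safe \<alpha> s 1 E" using safe_isolated by simp
      with k[of "{{}}" s] obtain Q where Q: "whp \<alpha> Q" "\<And>G H. Q G \<Longrightarrow> Q H \<Longrightarrow> averages_determined \<alpha> k s \<epsilon> t {} G H"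
        by blast
      show "\<exists>Q. whp \<alpha> Q \<and> (\<forall>G H. Q G \<longrightarrow> Q H \<longrightarrow> approx_determined \<alpha> k s \<epsilon> (AvgT v t) G H)"
      proof (intro exI[of _ Q] conjI allI impI Q(1))
        fix G H assume GH: "Q G" "Q H"
        show "approx_determined \<alpha> k s \<epsilon> (AvgT v t) G H"
          unfolding approx_determined_def term_value.simps
        proof (intro allI impI)
          fix z z' h assume iso: "strong_iso \<alpha> k s G H z z'" and h: "\<forall>x\<in>free_vars (AvgT v t). h x < s"
          have "verts G - z ` {..<s} = (\<lambda>y. y s) ` copies G z s 1 {}"
            "verts H - z' ` {..<s} = (\<lambda>y. y s) ` copies H z' s 1 {}"
            using iso by (subst new_vertices_of_copies; auto simp: strong_iso_def strong_def)+
          from averages_determinedD(3)[OF Q(2)[OF GH] iso _ order_refl this(1) order_refl this(2), of v h]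
          show "\<bar>(\<Sum>a\<in>verts G. term_value G ((z \<circ> h)(v := a)) t) / real (card (verts G)) -
             (\<Sum>a\<in>verts H. term_value H ((z' \<circ> h)(v := a)) t) / real (card (verts H))\<bar> \<le> \<epsilon>"
            using h by simp
        qed
      qed
    qed
  qed
next
  case (LAvgT w v t)
  then have t: "agg_lp_term t" "whp_determined \<alpha> t" by auto
  show ?case
    unfolding whp_determined_def
  proof (intro allI impI)
    fix \<epsilon> :: real assume \<epsilon>: "0 < \<epsilon>"
    obtain k where k: "\<And>s \<E>. finite \<E> \<Longrightarrow> (\<forall>E\<in>\<E>. safe \<alpha> s 1 E) \<Longrightarrow>
        \<exists>Q. whp \<alpha> Q \<and> (\<forall>G H E. Q G \<longrightarrow> Q H \<longrightarrow> E \<in> \<E> \<longrightarrow> averages_determined \<alpha> k s \<epsilon> t E G H)"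
      using whp_determined_average[OF al(1,3) t \<epsilon>] by blast
    show "\<exists>k. \<forall>s. \<exists>Q. whp \<alpha> Q \<and> (\<forall>G H. Q G \<longrightarrow> Q H \<longrightarrow> approx_determined \<alpha> k s \<epsilon> (LAvgT w v t) G H)"
    proof (intro exI[of _ k] allI)
      fix s :: nat
      \<comment> \<open>The centre \<open>w\<close> may sit at any position below s while
        \<open>Q\<close> must not depend on it, so all pendant templates are taken together.\<close>
      let ?\<E> = "(\<lambda>i. {{i, s}}) ` {..<s}"
      have "finite ?\<E>" "\<forall>E\<in>?\<E>. safe \<alpha> s 1 E" using safe_pendant(2)[OF al(2)] by auto
      with k[of ?\<E> s] obtain Q where Q: "whp \<alpha> Q"
          "\<And>G H E. Q G \<Longrightarrow> Q H \<Longrightarrow> E \<in> ?\<E> \<Longrightarrow> averages_determined \<alpha> k s \<epsilon> t E G H"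
        by blast
      show "\<exists>Q. whp \<alpha> Q \<and> (\<forall>G H. Q G \<longrightarrow> Q H \<longrightarrow> approx_determined \<alpha> k s \<epsilon> (LAvgT w v t) G H)"
      proof (intro exI[of _ Q] conjI allI impI Q(1))
        fix G H assume GH: "Q G" "Q H"
        show "approx_determined \<alpha> k s \<epsilon> (LAvgT w v t) G H"
          unfolding approx_determined_def
        proof (intro allI impI)
          fix z z' h assume iso: "strong_iso \<alpha> k s G H z z'" and h: "\<forall>x\<in>free_vars (LAvgT w v t). h x < s"
          then have hw: "h w < s" and h': "\<forall>x\<in>free_vars t - {v}. h x < s" by auto
          have nb: "neighbours G' (y (h w)) - y ` {..<s} = (\<lambda>y. y s) ` copies G' y s 1 {{h w, s}}"
            if "inj_on y {..<s}" "y ` {..<s} \<subseteq> verts G'" for y and G' :: "nat graph"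
            using hw by (subst new_vertices_of_copies[OF that safe_pendant(1)[OF al(2) hw]]) (auto simp: neighbours_def)
          have X: "neighbours G (z (h w)) - z ` {..<s} = (\<lambda>y. y s) ` copies G z s 1 {{h w, s}}"
            "neighbours H (z' (h w)) - z' ` {..<s} = (\<lambda>y. y s) ` copies H z' s 1 {{h w, s}}"
            using iso by (intro nb; auto simp: strong_iso_def strong_def)+
          have V: "neighbours G (z (h w)) \<subseteq> verts G" "neighbours H (z' (h w)) \<subseteq> verts H"
            by (auto simp: neighbours_def)
          have "averages_determined \<alpha> k s \<epsilon> t {{h w, s}} G H" by (rule Q(2)[OF GH]) (use hw in blast)
          note avg = averages_determinedD[OF this iso _ V(1) X(1) V(2) X(2), of v h]
          \<comment> \<open>With both neighbourhoods nonempty, neither graph takes the default value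
            0.\<close>
          have "neighbours G (z (h w)) \<noteq> {}" by (rule avg(1)) (use h' in blast)
          moreover have "neighbours H (z' (h w)) \<noteq> {}" by (rule avg(2)) (use h' in blast)
          ultimately show "\<bar>term_value G (z \<circ> h) (LAvgT w v t) - term_value H (z' \<circ> h) (LAvgT w v t)\<bar> \<le> \<epsilon>"
            using avg(3) h' by simp
        qed
      qed
    qed
  qed
next
  case (MaxT v t)
  then have t: "whp_determined \<alpha> t" by auto
  show ?case
    unfolding whp_determined_def
  proof (intro allI impI)
    fix \<epsilon> :: real assume \<epsilon>: "0 < \<epsilon>"
    then obtain k where k: "\<And>s. \<exists>Q. whp \<alpha> Q \<and> (\<forall>G H. Q G \<longrightarrow> Q H \<longrightarrow> approx_determined \<alpha> k s \<epsilon> t G H)"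
      using t unfolding whp_determined_def by blast
    obtain L where L: "\<And>(G :: nat graph) A a. wf_graph G \<Longrightarrow> strong \<alpha> L G A \<Longrightarrow> a \<in> verts G \<Longrightarrow>
      \<exists>B. insert a A \<subseteq> B \<and> B \<subseteq> verts G \<and> card (B - A) \<le> L \<and> strong \<alpha> k G B"
      using strong_closure[OF al(1), of k] by metis
    show "\<exists>k. \<forall>s. \<exists>Q. whp \<alpha> Q \<and> (\<forall>G H. Q G \<longrightarrow> Q H \<longrightarrow> approx_determined \<alpha> k s \<epsilon> (MaxT v t) G H)"
    \<comment> \<open>A closure has at most \<open>L\<close> new vertices, and its copy in the other
      graph has to be strong at level \<open>k\<close> again.\<close>
    proof (intro exI[of _ "L + k"] allI)
      fix s
      obtain Q where Q: "\<And>r. whp \<alpha> (Q r)" "\<And>r G H. Q r G \<Longrightarrow> Q r H \<Longrightarrow> approx_determined \<alpha> k r \<epsilon> t G H"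
        using k by metis
      define I where "I = {(r, E). 1 \<le> r \<and> r \<le> L \<and> safe \<alpha> s r E}"
      have finI: "finite I"
        by (rule finite_subset[of _ "Sigma {..L} (\<lambda>r. Pow (slots s r))"]) (auto simp: I_def safe_def finite_slots)
      \<comment> \<open>The number r of new vertices in the closure is not known in advance; the
        event covers all r up to \<open>L\<close>, at one level \<open>k\<close>.\<close>
      let ?Q = "\<lambda>G. (wf_graph G \<and> 1 \<le> card (verts G)) \<and> (\<forall>r\<in>{..L}. Q (s + r) G) \<and>
         (\<forall>x\<in>I. gen_ext \<alpha> s (fst x) (snd x) k (1 / 2) G)"
      show "\<exists>Q. whp \<alpha> Q \<and> (\<forall>G H. Q G \<longrightarrow> Q H \<longrightarrow> approx_determined \<alpha> (L + k) s \<epsilon> (MaxT v t) G H)"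
      proof (rule exI[of _ ?Q], intro conjI allI impI)
        show "whp \<alpha> ?Q"
          by (intro whp_conj[OF whp_wf_graph] whp_conj whp_ball_finite[OF finI] whp_gen_ext[OF al(1,3)]
              whp_ball_finite[of "{..L}"] Q(1)) (auto simp: I_def)
        have dir: "Max ((\<lambda>a. term_value G ((z \<circ> h)(v := a)) t) ` verts G)
            \<le> Max ((\<lambda>a. term_value H ((z' \<circ> h)(v := a)) t) ` verts H) + \<epsilon>"
          if G: "?Q G" and H: "?Q H" and iso: "strong_iso \<alpha> (L + k) s G H z z'" and h: "\<forall>x\<in>free_vars t - {v}. h x < s"
          for G H z z' h
        proof (rule Max_image_le)
          fix a assume a: "a \<in> verts G"
          have "\<exists>a'\<in>verts H. \<bar>term_value G ((z \<circ> h)(v := a)) t - term_value H ((z' \<circ> h)(v := a')) t\<bar> \<le> \<epsilon>"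
          proof (rule matching_witness[OF al(3) _ _ L _ _ iso _ a])
            show "approx_determined \<alpha> k (s + r) \<epsilon> t G H" if "r \<le> L" for r
              using Q(2) G H that by auto
            show "gen_ext \<alpha> s r E k (1 / 2) H" if "1 \<le> r" "r \<le> L" "safe \<alpha> s r E" for r E
              using H that by (force simp: I_def)
          qed (use G H h in auto)
          then show "\<exists>a'\<in>verts H. term_value G ((z \<circ> h)(v := a)) t \<le> term_value H ((z' \<circ> h)(v := a')) t + \<epsilon>"
            by (force simp: abs_le_iff)
        qed (use G H in \<open>auto simp: wf_graph_def\<close>)
        fix G H assume G: "?Q G" and H: "?Q H"
        show "approx_determined \<alpha> (L + k) s \<epsilon> (MaxT v t) G H"
          unfolding approx_determined_def term_value.simps
        proof (intro allI impI)
          fix z z' h assume iso: "strong_iso \<alpha> (L + k) s G H z z'" and h: "\<forall>x\<in>free_vars (MaxT v t). h x < s"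
          then have h': "\<forall>x\<in>free_vars t - {v}. h x < s" by simp
          show "\<bar>Max ((\<lambda>a. term_value G ((z \<circ> h)(v := a)) t) ` verts G) -
              Max ((\<lambda>a. term_value H ((z' \<circ> h)(v := a)) t) ` verts H)\<bar> \<le> \<epsilon>"
            using dir[OF G H iso h'] dir[OF H G strong_iso_sym[OF iso] h'] by linarith
        qed
      qed
    qed
  qed
qed

section \<open>From the comparison of two graphs to convergence in probability\<close>

theorem theorem6p22:
  fixes \<alpha> :: real and \<tau> :: agg_term
  assumes "0 < \<alpha>" and "\<alpha> < 1" and "\<alpha> \<notin> \<rat>"
    and "agg_lp_term \<tau>" and "closed_term \<tau>"
  shows "\<exists>c. converges_in_prob_to_const
               (\<lambda>n. measure_pmf (gnp n (real n powr (-\<alpha>)))) (\<lambda>n. closed_term_value \<tau>) c"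
proof -
  let ?val = "\<lambda>G :: nat graph. closed_term_value \<tau> G"
  have "\<exists>Q. whp \<alpha> Q \<and> (\<forall>G H. Q G \<longrightarrow> Q H \<longrightarrow> \<bar>?val G - ?val H\<bar> \<le> \<epsilon>)" if \<epsilon>: "0 < \<epsilon>" for \<epsilon>
  proof -
    obtain k where "\<forall>s. \<exists>Q. whp \<alpha> Q \<and> (\<forall>G H. Q G \<longrightarrow> Q H \<longrightarrow> approx_determined \<alpha> k s \<epsilon> \<tau> G H)"
      using agg_lp_term_determined[OF assms(1-4)] \<epsilon> unfolding whp_determined_def by blast
    then obtain Q where Q: "whp \<alpha> Q" "\<And>G H. Q G \<Longrightarrow> Q H \<Longrightarrow> approx_determined \<alpha> k 0 \<epsilon> \<tau> G H"
      by blast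
    have "\<bar>?val G - ?val H\<bar> \<le> \<epsilon>" if "Q G" "strong \<alpha> k G {}" "Q H" "strong \<alpha> k H {}" for G H
    proof -
      \<comment> \<open>The game starts at the empty tuple, where only strongness of the empty set
        has to be known.\<close>
      have "strong_iso \<alpha> k 0 G H (\<lambda>_. 0) (\<lambda>_. 0)" using that by (simp add: strong_iso_def)
      from approx_determinedD[OF Q(2)[OF that(1,3)] this, of id]
      show ?thesis
        using assms(5) by (simp add: closed_term_def closed_term_value_eq[OF assms(5), where \<nu> = "\<lambda>_. 0"])
    qed
    then show ?thesis
      by (intro exI[of _ "\<lambda>G. Q G \<and> strong \<alpha> k G {}"] conjI whp_conj Q(1) whp_strong_empty assms(1)) blast
  qed
  then have "\<exists>Q. whp \<alpha> Q \<and> (\<forall>G H. Q G \<longrightarrow> Q H \<longrightarrow> \<bar>?val G - ?val H\<bar> \<le> 1 / real (Suc j))" for j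
    by simp
  then obtain Q where Q: "\<And>j. whp \<alpha> (Q j)" "\<And>j G H. Q j G \<Longrightarrow> Q j H \<Longrightarrow> \<bar>?val G - ?val H\<bar> \<le> 1 / real (Suc j)"
    by metis
  \<comment> \<open>One representative graph for each accuracy; their values will converge to the
    constant sought.\<close>
  obtain \<Gamma> where \<Gamma>: "\<And>j. Q j (\<Gamma> j)" using whp_ex[OF Q(1)] by metis
  have close: "\<bar>?val (\<Gamma> i) - ?val (\<Gamma> j)\<bar> \<le> 1 / real (Suc i) + 1 / real (Suc j)" for i j
  proof -
    \<comment> \<open>Two high-probability events share a graph, which mediates between the two
      representatives.\<close>
    obtain H where "Q i H" "Q j H" using whp_ex[OF whp_conj[OF Q(1)[of i] Q(1)[of j]]] by blast
    then show ?thesis using Q(2)[OF \<Gamma>[of i], of H] Q(2)[OF \<Gamma>[of j], of H] by linarith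
  qed
  have "Cauchy (\<lambda>j. ?val (\<Gamma> j))"
  proof (rule metric_CauchyI)
    fix e :: real assume "0 < e"
    then obtain m where m: "1 / real (Suc m) < e / 2" using nat_approx_posE[of "e / 2"] by auto
    have "dist (?val (\<Gamma> i)) (?val (\<Gamma> j)) < e" if "m \<le> i" "m \<le> j" for i j
    proof -
      have "1 / real (Suc i) \<le> 1 / real (Suc m)" "1 / real (Suc j) \<le> 1 / real (Suc m)"
        using that by (auto intro!: divide_left_mono)
      then show ?thesis using close[of i j] m unfolding dist_real_def by linarith
    qed
    then show "\<exists>m. \<forall>i\<ge>m. \<forall>j\<ge>m. dist (?val (\<Gamma> i)) (?val (\<Gamma> j)) < e" by blast
  qed
  then obtain c where c: "(\<lambda>j. ?val (\<Gamma> j)) \<longlonglongrightarrow> c" using Cauchy_convergent convergent_def by blast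
  show ?thesis
    unfolding converges_in_prob_to_const_def
  proof (intro exI[of _ c] allI impI)
    fix \<epsilon> :: real assume "0 < \<epsilon>"
    then have e: "0 < \<epsilon> / 2" by simp
    obtain m where m: "1 / real (Suc m) < \<epsilon> / 2" using nat_approx_posE[OF e] by auto
    obtain m' where m': "\<And>j. m' \<le> j \<Longrightarrow> \<bar>?val (\<Gamma> j) - c\<bar> < \<epsilon> / 2"
      using metric_LIMSEQ_D[OF c e] by (auto simp: dist_real_def)
    define j where "j = max m m'"
    have "1 / real (Suc j) \<le> 1 / real (Suc m)" by (auto simp: j_def intro!: divide_left_mono)
    then have j: "1 / real (Suc j) < \<epsilon> / 2" using m by linarith
    have cj: "\<bar>?val (\<Gamma> j) - c\<bar> < \<epsilon> / 2" by (rule m') (simp add: j_def)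
    have "whp \<alpha> (\<lambda>G. \<not> \<bar>?val G - c\<bar> > \<epsilon>)"
    proof (rule whp_mono[OF Q(1)[of j]])
      fix G assume "Q j G"
      then show "\<not> \<bar>?val G - c\<bar> > \<epsilon>" using Q(2)[OF _ \<Gamma>[of j], of G] j cj by linarith
    qed
    then show "(\<lambda>n. measure (measure_pmf (gnp n (real n powr (-\<alpha>))))
        {\<omega> \<in> space (measure_pmf (gnp n (real n powr (-\<alpha>)))). \<bar>?val \<omega> - c\<bar> > \<epsilon>}) \<longlonglongrightarrow> 0"
      by (simp add: whp_def)
  qed
qed

end
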